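(* Let $P=(\mathcal{A},\mathcal{C})$ be a measuring left $R$-pairing. The weak linear topology $\mathcal{A}[\mathfrak{T}^r_{ls}(\mathcal{C})]$ and the $\mathcal{C}$-adic topology $\mathcal{T}_{-\mathcal{C}}(\mathcal{A})$ coincide. In particular $(\mathcal{A},\mathcal{A}[\mathfrak{T}^r_{ls}(\mathcal{C})])$ is a right linear topological $R$-ring, and a right $\mathcal{A}$-module $M$ is $(\mathcal{A},\mathcal{A}[\mathfrak{T}^r_{ls}(\mathcal{C})])$-discrete if and only if $M_{\mathcal{A}}$ is $\mathcal{C}$-subgenerated.
   Context: $R$ is an associative (not necessarily commutative) ring with $1\neq 0$. An $R$-ring is an $R$-bimodule $\mathcal{A}$ with an associative $R$-bilinear multiplication $\mathcal{A}\otimes_R\mathcal{A}\to\mathcal{A}$, with unity (given by an $R$-bilinear unit map $R\to\mathcal{A}$); morphisms are $R$-bilinear, multiplicative and preserve unities. Modules are unital. An $R$-coring is an $R$-bimodule $\mathcal{C}$ with $R$-bilinear coassociative $\Delta(c)=\sum c_1\otimes c_2\in\mathcal{C}\otimes_R\mathcal{C}$ and counit $\varepsilon_{\mathcal{C}}:\mathcal{C}\to R$. ${}^{*}\mathcal{C}:=\mathrm{Hom}_{R-}(\mathcal{C},R)$ (left $R$-linear maps) is an $R$-ring with $(rf)(c)=f(cr)$, $(fr)(c)=f(c)r$, $(f\star g)(c)=\sum g(c_1f(c_2))$, unity $\varepsilon_{\mathcal{C}}$. A measuring left $R$-pairing $P=(\mathcal{A},\mathcal{C})$ consists of an $R$-ring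 $\mathcal{A}$, an $R$-coring $\mathcal{C}$ and a morphism of $R$-rings $\kappa_P:\mathcal{A}\to{}^{*}\mathcal{C}$; write $\langle a,c\rangle=\kappa_P(a)(c)$. $\mathcal{C}$ is a right $\mathcal{A}$-module by $c\leftharpoonup a=\sum c_1\langle a,c_2\rangle$. The weak linear topology $\mathcal{A}[\mathfrak{T}^r_{ls}(\mathcal{C})]$ is the linear topology on $\mathcal{A}$ with neighbourhood base of $0$ the right $R$-submodules $F^{\bot}=\{a:\langle a,c\rangle=0\ \forall c\in F\}$, $F\subset\mathcal{C}$ finite. The $\mathcal{C}$-adic topology $\mathcal{T}_{-\mathcal{C}}(\mathcal{A})$ is the linear topology with neighbourhood base of $0$ the right $\mathcal{A}$-ideals $(0_{\mathcal{C}}:F)=\{a: c\leftharpoonup a=0\ \forall c\in F\}$, $F\subset\mathcal{C}$ finite. A right linear topological ring is a topological ring having a neighbourhood base of $0$ consisting of right ideals; a right module $M$ over it is discrete if for every $m\in M$ the annihilator $\{a: ma=0\}$ is open. A right $\mathcal{A}$-module is $\mathcal{C}$-subgenerated if it is isomorphic to a submodule of a quotient of a direct sum of copies of $\mathcal{C}_{\mathcal{A}}$. *)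

theory Defs
  imports
    "HOL-Algebra.AbelCoset"
    "HOL-Algebra.Free_Abelian_Groups"
    "HOL-Analysis.Product_Topology"
begin

section \<open>Modules and bimodules\<close>

text \<open>As for the modules of HOL-Algebra, the module records extend the ring record and only its additive
  part is used; HOL-Algebra's own modules are left modules over commutative rings. An \<open>R\<close>-ring is a
  bimodule record that uses the multiplicative part as well.\<close>

record ('r, 'm) rmod = "'m ring" +
  rsmult :: "['m, 'r] \<Rightarrow> 'm"  (infixl \<open>\<leftharpoonup>\<index>\<close> 70)

record ('r, 'm) bimod = "('r, 'm) rmod" +
  lsmult :: "['r, 'm] \<Rightarrow> 'm"  (infixr \<open>\<rightharpoonup>\<index>\<close> 71)

locale right_module = R?: ring R + M?: abelian_group M
  for R :: "('r, 'x) ring_scheme" (structure) and M :: "('r, 'm, 'y) rmod_scheme" (structure) +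
  assumes rsmult_closed [simp, intro]:
      "\<lbrakk>x \<in> carrier M; r \<in> carrier R\<rbrakk> \<Longrightarrow> x \<leftharpoonup>\<^bsub>M\<^esub> r \<in> carrier M"
    and rsmult_l_distr:
      "\<lbrakk>x \<in> carrier M; y \<in> carrier M; r \<in> carrier R\<rbrakk>
        \<Longrightarrow> (x \<oplus>\<^bsub>M\<^esub> y) \<leftharpoonup>\<^bsub>M\<^esub> r = x \<leftharpoonup>\<^bsub>M\<^esub> r \<oplus>\<^bsub>M\<^esub> y \<leftharpoonup>\<^bsub>M\<^esub> r"
    and rsmult_r_distr:
      "\<lbrakk>x \<in> carrier M; r \<in> carrier R; s \<in> carrier R\<rbrakk>
        \<Longrightarrow> x \<leftharpoonup>\<^bsub>M\<^esub> (r \<oplus>\<^bsub>R\<^esub> s) = x \<leftharpoonup>\<^bsub>M\<^esub> r \<oplus>\<^bsub>M\<^esub> x \<leftharpoonup>\<^bsub>M\<^esub> s"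
    and rsmult_assoc:
      "\<lbrakk>x \<in> carrier M; r \<in> carrier R; s \<in> carrier R\<rbrakk>
        \<Longrightarrow> x \<leftharpoonup>\<^bsub>M\<^esub> (r \<otimes>\<^bsub>R\<^esub> s) = (x \<leftharpoonup>\<^bsub>M\<^esub> r) \<leftharpoonup>\<^bsub>M\<^esub> s"
    and rsmult_one [simp]:
      "x \<in> carrier M \<Longrightarrow> x \<leftharpoonup>\<^bsub>M\<^esub> \<one>\<^bsub>R\<^esub> = x"

locale bimodule = right_module R M
  for R :: "('r, 'x) ring_scheme" (structure) and M :: "('r, 'm, 'y) bimod_scheme" (structure) +
  assumes lsmult_closed [simp, intro]:
      "\<lbrakk>r \<in> carrier R; x \<in> carrier M\<rbrakk> \<Longrightarrow> r \<rightharpoonup>\<^bsub>M\<^esub> x \<in> carrier M"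
    and lsmult_r_distr:
      "\<lbrakk>r \<in> carrier R; x \<in> carrier M; y \<in> carrier M\<rbrakk>
        \<Longrightarrow> r \<rightharpoonup>\<^bsub>M\<^esub> (x \<oplus>\<^bsub>M\<^esub> y) = (r \<rightharpoonup>\<^bsub>M\<^esub> x) \<oplus>\<^bsub>M\<^esub> (r \<rightharpoonup>\<^bsub>M\<^esub> y)"
    and lsmult_l_distr:
      "\<lbrakk>r \<in> carrier R; s \<in> carrier R; x \<in> carrier M\<rbrakk>
        \<Longrightarrow> (r \<oplus>\<^bsub>R\<^esub> s) \<rightharpoonup>\<^bsub>M\<^esub> x = (r \<rightharpoonup>\<^bsub>M\<^esub> x) \<oplus>\<^bsub>M\<^esub> (s \<rightharpoonup>\<^bsub>M\<^esub> x)"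
    and lsmult_assoc:
      "\<lbrakk>r \<in> carrier R; s \<in> carrier R; x \<in> carrier M\<rbrakk>
        \<Longrightarrow> (r \<otimes>\<^bsub>R\<^esub> s) \<rightharpoonup>\<^bsub>M\<^esub> x = r \<rightharpoonup>\<^bsub>M\<^esub> (s \<rightharpoonup>\<^bsub>M\<^esub> x)"
    and lsmult_one [simp]:
      "x \<in> carrier M \<Longrightarrow> \<one>\<^bsub>R\<^esub> \<rightharpoonup>\<^bsub>M\<^esub> x = x"
    and lsmult_rsmult_assoc:
      "\<lbrakk>r \<in> carrier R; x \<in> carrier M; s \<in> carrier R\<rbrakk>
        \<Longrightarrow> (r \<rightharpoonup>\<^bsub>M\<^esub> x) \<leftharpoonup>\<^bsub>M\<^esub> s = r \<rightharpoonup>\<^bsub>M\<^esub> (x \<leftharpoonup>\<^bsub>M\<^esub> s)"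

definition regular_bimod :: "('r, 'x) ring_scheme \<Rightarrow> ('r, 'r) bimod"
  where "regular_bimod R =
    \<lparr>carrier = carrier R, monoid.mult = monoid.mult R, monoid.one = \<one>\<^bsub>R\<^esub>, ring.zero = \<zero>\<^bsub>R\<^esub>, add = add R,
     rsmult = monoid.mult R, lsmult = monoid.mult R\<rparr>"

definition bimodule_hom ::
    "('r, 'x) ring_scheme \<Rightarrow> ('r, 'm, 'y) bimod_scheme \<Rightarrow> ('r, 'n, 'z) bimod_scheme \<Rightarrow> ('m \<Rightarrow> 'n) set"
  where "bimodule_hom R M N = {f \<in> carrier M \<rightarrow> carrier N.
    (\<forall>x\<in>carrier M. \<forall>y\<in>carrier M. f (x \<oplus>\<^bsub>M\<^esub> y) = f x \<oplus>\<^bsub>N\<^esub> f y) \<and>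
    (\<forall>r\<in>carrier R. \<forall>x\<in>carrier M. f (r \<rightharpoonup>\<^bsub>M\<^esub> x) = r \<rightharpoonup>\<^bsub>N\<^esub> f x) \<and>
    (\<forall>x\<in>carrier M. \<forall>r\<in>carrier R. f (x \<leftharpoonup>\<^bsub>M\<^esub> r) = f x \<leftharpoonup>\<^bsub>N\<^esub> r)}"


section \<open>Tensor products over a noncommutative ring\<close>

text \<open>\<open>M \<otimes>\<^sub>R N\<close> is the free abelian group on \<open>carrier M \<times> carrier N\<close> modulo the subgroup generated
  by the biadditivity and balancing relations; its elements are cosets of that subgroup.\<close>

type_synonym ('m, 'n) tens = "('m \<times> 'n \<Rightarrow>\<^sub>0 int) set"

definition tensor_free ::
    "('r, 'm, 'y) bimod_scheme \<Rightarrow> ('r, 'n, 'z) bimod_scheme \<Rightarrow> ('m \<times> 'n \<Rightarrow>\<^sub>0 int) monoid"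
  where "tensor_free M N = free_Abelian_group (carrier M \<times> carrier N)"

definition tensor_relators ::
    "('r, 'x) ring_scheme \<Rightarrow> ('r, 'm, 'y) bimod_scheme \<Rightarrow> ('r, 'n, 'z) bimod_scheme
      \<Rightarrow> ('m \<times> 'n \<Rightarrow>\<^sub>0 int) set"
  where "tensor_relators R M N =
    {frag_of (x \<oplus>\<^bsub>M\<^esub> x', y) - frag_of (x, y) - frag_of (x', y) | x x' y.
      x \<in> carrier M \<and> x' \<in> carrier M \<and> y \<in> carrier N} \<union>
    {frag_of (x, y \<oplus>\<^bsub>N\<^esub> y') - frag_of (x, y) - frag_of (x, y') | x y y'.
      x \<in> carrier M \<and> y \<in> carrier N \<and> y' \<in> carrier N} \<union>
    {frag_of (x \<leftharpoonup>\<^bsub>M\<^esub> r, y) - frag_of (x, r \<rightharpoonup>\<^bsub>N\<^esub> y) | x r y.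
      x \<in> carrier M \<and> r \<in> carrier R \<and> y \<in> carrier N}"

definition tensor_kernel ::
    "('r, 'x) ring_scheme \<Rightarrow> ('r, 'm, 'y) bimod_scheme \<Rightarrow> ('r, 'n, 'z) bimod_scheme
      \<Rightarrow> ('m \<times> 'n \<Rightarrow>\<^sub>0 int) set"
  where "tensor_kernel R M N = generate (tensor_free M N) (tensor_relators R M N)"

definition pure_tensor ::
    "('r, 'x) ring_scheme \<Rightarrow> ('r, 'm, 'y) bimod_scheme \<Rightarrow> ('r, 'n, 'z) bimod_scheme
      \<Rightarrow> 'm \<Rightarrow> 'n \<Rightarrow> ('m, 'n) tens"
  where "pure_tensor R M N x y = tensor_kernel R M N #>\<^bsub>tensor_free M N\<^esub> frag_of (x, y)"

text \<open>\<open>(x \<otimes> y) r = x \<otimes> y r\<close> and \<open>r (x \<otimes> y) = r x \<otimes> y\<close>.\<close>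

definition tensor ::
    "('r, 'x) ring_scheme \<Rightarrow> ('r, 'm, 'y) bimod_scheme \<Rightarrow> ('r, 'n, 'z) bimod_scheme
      \<Rightarrow> ('r, ('m, 'n) tens) bimod"
  where "tensor R M N =
    \<lparr>carrier = rcosets\<^bsub>tensor_free M N\<^esub> (tensor_kernel R M N),
     monoid.mult = undefined, monoid.one = undefined,
     ring.zero = tensor_kernel R M N,
     add = set_mult (tensor_free M N),
     rsmult = (\<lambda>T r. \<Union>t\<in>T. tensor_kernel R M N #>\<^bsub>tensor_free M N\<^esub>
       frag_extend (\<lambda>(x, y). frag_of (x, y \<leftharpoonup>\<^bsub>N\<^esub> r)) t),
     lsmult = (\<lambda>r T. \<Union>t\<in>T. tensor_kernel R M N #>\<^bsub>tensor_free M N\<^esub>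
       frag_extend (\<lambda>(x, y). frag_of (r \<rightharpoonup>\<^bsub>M\<^esub> x, y)) t)\<rparr>"

text \<open>The additive map \<open>\<Sum> x\<^sub>i \<otimes> y\<^sub>i \<mapsto> \<Sum> f (x\<^sub>i, y\<^sub>i)\<close> on \<open>M \<otimes>\<^sub>R N\<close> induced by a balanced map
  \<open>f\<close> into an abelian group \<open>G\<close>, evaluated on a representative of the coset. The value does not
  depend on the representative when \<open>f\<close> is biadditive and balanced, see \<open>tensor_lift_coset\<close> below.\<close>

definition frag_eval :: "('g, 'x) ring_scheme \<Rightarrow> ('m \<times> 'n \<Rightarrow> 'g) \<Rightarrow> ('m \<times> 'n \<Rightarrow>\<^sub>0 int) \<Rightarrow> 'g"
  where "frag_eval G f t =
    (\<Oplus>\<^bsub>G\<^esub>p\<in>Poly_Mapping.keys t. [Poly_Mapping.lookup t p] \<cdot>\<^bsub>G\<^esub> f p)"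

definition tensor_lift :: "('g, 'x) ring_scheme \<Rightarrow> ('m \<times> 'n \<Rightarrow> 'g) \<Rightarrow> ('m, 'n) tens \<Rightarrow> 'g"
  where "tensor_lift G f T = frag_eval G f (SOME t. t \<in> T)"

lemma frag_eval_superset:
  assumes "abelian_group G" "f \<in> S \<rightarrow> carrier G" "finite S" "Poly_Mapping.keys t \<subseteq> S"
  shows "frag_eval G f t = (\<Oplus>\<^bsub>G\<^esub>p\<in>S. [Poly_Mapping.lookup t p] \<cdot>\<^bsub>G\<^esub> f p)"
proof -
  interpret abelian_group G by fact
  have "[Poly_Mapping.lookup t p] \<cdot>\<^bsub>G\<^esub> f p = \<zero>\<^bsub>G\<^esub>" if "p \<in> S - Poly_Mapping.keys t" for p
    using that by (simp add: in_keys_iff add_pow_def)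
  moreover have "[k] \<cdot>\<^bsub>G\<^esub> f p \<in> carrier G" if "p \<in> S" for p and k :: int
    using that assms(2) by (auto intro: add.int_pow_closed)
  ultimately show ?thesis
    unfolding frag_eval_def using assms(3,4)
    by (intro add.finprod_mono_neutral_cong_left) auto
qed

lemma frag_eval_add:
  assumes "abelian_group G" "f \<in> S \<rightarrow> carrier G"
    "Poly_Mapping.keys s \<subseteq> S" "Poly_Mapping.keys t \<subseteq> S"
  shows "frag_eval G f (s + t) = frag_eval G f s \<oplus>\<^bsub>G\<^esub> frag_eval G f t"
proof -
  interpret abelian_group G by fact
  let ?K = "Poly_Mapping.keys s \<union> Poly_Mapping.keys t"
  have f: "f \<in> ?K \<rightarrow> carrier G" using assms by auto
  have cl: "[k] \<cdot>\<^bsub>G\<^esub> f p \<in> carrier G" if "p \<in> ?K" for p and k :: int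
    using that f by (auto intro: add.int_pow_closed)
  have "frag_eval G f (s + t) = (\<Oplus>\<^bsub>G\<^esub>p\<in>?K. [Poly_Mapping.lookup (s + t) p] \<cdot>\<^bsub>G\<^esub> f p)"
    by (rule frag_eval_superset) (use assms(1) f Poly_Mapping.keys_add[of s t] in auto)
  also have "\<dots> = (\<Oplus>\<^bsub>G\<^esub>p\<in>?K. [Poly_Mapping.lookup s p] \<cdot>\<^bsub>G\<^esub> f p \<oplus>\<^bsub>G\<^esub> [Poly_Mapping.lookup t p] \<cdot>\<^bsub>G\<^esub> f p)"
  proof (rule finsum_cong')
    fix p assume p: "p \<in> ?K"
    then have "f p \<in> carrier G" using f by (rule_tac Pi_mem)
    then show "[Poly_Mapping.lookup (s + t) p] \<cdot>\<^bsub>G\<^esub> f p =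
        [Poly_Mapping.lookup s p] \<cdot>\<^bsub>G\<^esub> f p \<oplus>\<^bsub>G\<^esub> [Poly_Mapping.lookup t p] \<cdot>\<^bsub>G\<^esub> f p"
      by (simp add: lookup_add add.int_pow_mult)
  qed (use cl in auto)
  also have "\<dots> = (\<Oplus>\<^bsub>G\<^esub>p\<in>?K. [Poly_Mapping.lookup s p] \<cdot>\<^bsub>G\<^esub> f p)
      \<oplus>\<^bsub>G\<^esub> (\<Oplus>\<^bsub>G\<^esub>p\<in>?K. [Poly_Mapping.lookup t p] \<cdot>\<^bsub>G\<^esub> f p)"
    using cl by (intro finsum_addf) auto
  also have "\<dots> = frag_eval G f s \<oplus>\<^bsub>G\<^esub> frag_eval G f t"
    using frag_eval_superset[OF assms(1) f, of s] frag_eval_superset[OF assms(1) f, of t] by simp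
  finally show ?thesis .
qed

lemma frag_eval_of:
  assumes "abelian_group G" "f p \<in> carrier G"
  shows "frag_eval G f (frag_of p) = f p"
proof -
  interpret abelian_group G by fact
  have "frag_eval G f (frag_of p) = (\<Oplus>\<^bsub>G\<^esub>q\<in>{p}. f q)"
    unfolding frag_eval_def using assms(2)
    by (intro finsum_cong') (auto simp: add.int_pow_1)
  also have "\<dots> = f p"
    using assms(2) finsum_insert[of "{}" p f] by simp
  finally show ?thesis .
qed

text \<open>The induced map is well defined.\<close>

lemma tensor_lift_coset:
  fixes R :: "('r, 'x) ring_scheme" and M :: "('r, 'm, 'y) bimod_scheme"
    and N :: "('r, 'n, 'z) bimod_scheme"
  assumes M: "bimodule R M" and N: "bimodule R N" and G: "abelian_group G"
    and f: "f \<in> carrier M \<times> carrier N \<rightarrow> carrier G"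
    and left: "\<And>x x' y. \<lbrakk>x \<in> carrier M; x' \<in> carrier M; y \<in> carrier N\<rbrakk>
      \<Longrightarrow> f (x \<oplus>\<^bsub>M\<^esub> x', y) = f (x, y) \<oplus>\<^bsub>G\<^esub> f (x', y)"
    and right: "\<And>x y y'. \<lbrakk>x \<in> carrier M; y \<in> carrier N; y' \<in> carrier N\<rbrakk>
      \<Longrightarrow> f (x, y \<oplus>\<^bsub>N\<^esub> y') = f (x, y) \<oplus>\<^bsub>G\<^esub> f (x, y')"
    and balanced: "\<And>x r y. \<lbrakk>x \<in> carrier M; r \<in> carrier R; y \<in> carrier N\<rbrakk>
      \<Longrightarrow> f (x \<leftharpoonup>\<^bsub>M\<^esub> r, y) = f (x, r \<rightharpoonup>\<^bsub>N\<^esub> y)"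
    and t: "t \<in> carrier (tensor_free M N)"
  shows "tensor_lift G f (tensor_kernel R M N #>\<^bsub>tensor_free M N\<^esub> t) = frag_eval G f t"
proof -
  interpret G: abelian_group G by fact
  interpret M: bimodule R M by fact
  interpret N: bimodule R N by fact
  let ?S = "carrier M \<times> carrier N"
  let ?F = "tensor_free M N"
  let ?K = "tensor_kernel R M N"
  interpret F: group ?F by (simp add: tensor_free_def)
  have in_F: "u \<in> carrier ?F \<longleftrightarrow> Poly_Mapping.keys u \<subseteq> ?S" for u
    by (simp add: tensor_free_def free_Abelian_group_def)
  have mult_F: "u \<otimes>\<^bsub>?F\<^esub> v = u + v" for u v
    by (simp add: tensor_free_def free_Abelian_group_def)
  have closed: "frag_eval G f u \<in> carrier G" if "u \<in> carrier ?F" for u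
    unfolding frag_eval_def using that f in_F
    by (intro G.finsum_closed) (auto intro!: G.add.int_pow_closed)
  interpret h: group_hom ?F "add_monoid G" "frag_eval G f"
    by unfold_locales
      (auto simp: hom_def closed mult_F in_F intro!: frag_eval_add[OF G f])
  have diff: "frag_eval G f (u - v) = frag_eval G f u \<ominus>\<^bsub>G\<^esub> frag_eval G f v"
    if "u \<in> carrier ?F" "v \<in> carrier ?F" for u v
  proof -
    have "u - v \<in> carrier ?F"
      using that keys_diff[of u v] by (auto simp: in_F)
    then have "frag_eval G f u = frag_eval G f (u - v) \<oplus>\<^bsub>G\<^esub> frag_eval G f v"
      using that frag_eval_add[OF G f, of "u - v" v] by (simp add: in_F)
    then show ?thesis
      using that closed \<open>u - v \<in> carrier ?F\<close> by (simp add: a_minus_def G.minus_eq G.a_assoc G.r_neg)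
  qed
  have diff_closed: "u - v \<in> carrier ?F" if "u \<in> carrier ?F" "v \<in> carrier ?F" for u v
    using that keys_diff[of u v] by (auto simp: in_F)
  have of_closed: "frag_of (x, y) \<in> carrier ?F" if "x \<in> carrier M" "y \<in> carrier N" for x y
    using that by (simp add: in_F)
  have of_eval: "frag_eval G f (frag_of (x, y)) = f (x, y)" if "x \<in> carrier M" "y \<in> carrier N" for x y
    using that f by (intro frag_eval_of[OF G]) auto
  have f_closed: "f (x, y) \<in> carrier G" if "x \<in> carrier M" "y \<in> carrier N" for x y
    using that f by auto
  have cancel: "(a \<oplus>\<^bsub>G\<^esub> b) \<ominus>\<^bsub>G\<^esub> a \<ominus>\<^bsub>G\<^esub> b = \<zero>\<^bsub>G\<^esub>" if "a \<in> carrier G" "b \<in> carrier G" for a b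
    using that by (metis G.a_comm G.add.inv_closed G.add.m_assoc G.minus_eq G.r_neg G.r_zero G.add.m_closed)
  have self: "a \<ominus>\<^bsub>G\<^esub> a = \<zero>\<^bsub>G\<^esub>" if "a \<in> carrier G" for a
    using that by (simp add: G.minus_eq G.r_neg)
  have rel: "u \<in> carrier ?F \<and> frag_eval G f u = \<zero>\<^bsub>G\<^esub>" if "u \<in> tensor_relators R M N" for u
    using that unfolding tensor_relators_def
    by (auto simp: diff diff_closed of_closed of_eval f_closed left right balanced cancel self)
  have "tensor_relators R M N \<subseteq> kernel ?F (add_monoid G) (frag_eval G f)"
    using rel by (auto simp: kernel_def)
  then have ker: "?K \<subseteq> kernel ?F (add_monoid G) (frag_eval G f)"
    unfolding tensor_kernel_def using h.subgroup_kernel F.generate_subgroup_incl by blast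
  have K: "subgroup ?K ?F"
    unfolding tensor_kernel_def using rel by (intro F.generate_is_subgroup) auto
  have const: "frag_eval G f u = frag_eval G f t" if u: "u \<in> ?K #>\<^bsub>?F\<^esub> t" for u
  proof -
    obtain k where k: "k \<in> ?K" "u = k \<otimes>\<^bsub>?F\<^esub> t" using u unfolding r_coset_def by blast
    then have "k \<in> carrier ?F" "frag_eval G f k = \<zero>\<^bsub>G\<^esub>" using ker by (auto simp: kernel_def)
    then show ?thesis using k(2) t closed h.hom_mult[of k t] by simp
  qed
  have "t \<in> ?K #>\<^bsub>?F\<^esub> t" using F.rcos_self[OF t K] .
  then show ?thesis unfolding tensor_lift_def using const someI[of "\<lambda>u. u \<in> ?K #>\<^bsub>?F\<^esub> t" t] by blast
qed

definition tensor_map ::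
    "('r, 'x) ring_scheme \<Rightarrow> ('r, 'm, 'y) bimod_scheme \<Rightarrow> ('r, 'n, 'z) bimod_scheme
      \<Rightarrow> ('k \<Rightarrow> 'm) \<Rightarrow> ('l \<Rightarrow> 'n) \<Rightarrow> ('k, 'l) tens \<Rightarrow> ('m, 'n) tens"
  where "tensor_map R M N f g =
    tensor_lift (tensor R M N) (\<lambda>(x, y). pure_tensor R M N (f x) (g y))"

text \<open>The canonical isomorphism \<open>(L \<otimes> M) \<otimes> N \<rightarrow> L \<otimes> (M \<otimes> N)\<close>.\<close>

definition tensor_assoc ::
    "('r, 'x) ring_scheme \<Rightarrow> ('r, 'l, 'w) bimod_scheme \<Rightarrow> ('r, 'm, 'y) bimod_scheme
      \<Rightarrow> ('r, 'n, 'z) bimod_scheme \<Rightarrow> (('l, 'm) tens, 'n) tens \<Rightarrow> ('l, ('m, 'n) tens) tens"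
  where "tensor_assoc R L M N =
    tensor_lift (tensor R L (tensor R M N)) (\<lambda>(T, z).
      tensor_lift (tensor R L (tensor R M N)) (\<lambda>(x, y).
        pure_tensor R L (tensor R M N) x (pure_tensor R M N y z)) T)"


section \<open>R-rings, corings and measuring pairings\<close>

text \<open>The multiplication \<open>A \<otimes>\<^sub>R A \<rightarrow> A\<close> is given as a balanced biadditive map (biadditivity and
  associativity are part of \<^term>\<open>ring A\<close>), and the unit map as \<open>r \<mapsto> r 1 = 1 r\<close>. Note that
  \<^term>\<open>ring A\<close> does not exclude the zero ring.\<close>

locale r_ring = bimodule R A + A?: ring A
  for R :: "('r, 'x) ring_scheme" (structure) and A :: "('r, 'a, 'y) bimod_scheme" (structure) +
  assumes mult_left_linear:
      "\<lbrakk>r \<in> carrier R; a \<in> carrier A; b \<in> carrier A\<rbrakk>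
        \<Longrightarrow> (r \<rightharpoonup>\<^bsub>A\<^esub> a) \<otimes>\<^bsub>A\<^esub> b = r \<rightharpoonup>\<^bsub>A\<^esub> (a \<otimes>\<^bsub>A\<^esub> b)"
    and mult_right_linear:
      "\<lbrakk>a \<in> carrier A; b \<in> carrier A; r \<in> carrier R\<rbrakk>
        \<Longrightarrow> a \<otimes>\<^bsub>A\<^esub> (b \<leftharpoonup>\<^bsub>A\<^esub> r) = (a \<otimes>\<^bsub>A\<^esub> b) \<leftharpoonup>\<^bsub>A\<^esub> r"
    and mult_balanced:
      "\<lbrakk>a \<in> carrier A; r \<in> carrier R; b \<in> carrier A\<rbrakk>
        \<Longrightarrow> (a \<leftharpoonup>\<^bsub>A\<^esub> r) \<otimes>\<^bsub>A\<^esub> b = a \<otimes>\<^bsub>A\<^esub> (r \<rightharpoonup>\<^bsub>A\<^esub> b)"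
    and unit_bilinear:
      "r \<in> carrier R \<Longrightarrow> r \<rightharpoonup>\<^bsub>A\<^esub> \<one>\<^bsub>A\<^esub> = \<one>\<^bsub>A\<^esub> \<leftharpoonup>\<^bsub>A\<^esub> r"

definition r_ring_hom ::
    "('r, 'x) ring_scheme \<Rightarrow> ('r, 'a, 'y) bimod_scheme \<Rightarrow> ('r, 'b, 'z) bimod_scheme \<Rightarrow> ('a \<Rightarrow> 'b) set"
  where "r_ring_hom R A B = bimodule_hom R A B \<inter> ring_hom A B"

record ('r, 'c) coring = "('r, 'c) bimod" +
  comult :: "'c \<Rightarrow> ('c, 'c) tens"
  counit :: "'c \<Rightarrow> 'r"

locale r_coring = bimodule R C
  for R :: "('r, 'x) ring_scheme" (structure) and C :: "('r, 'c, 'y) coring_scheme" (structure) +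
  assumes comult_hom: "comult C \<in> bimodule_hom R C (tensor R C C)"
    and counit_hom: "counit C \<in> bimodule_hom R C (regular_bimod R)"
    and coassoc:
      "c \<in> carrier C \<Longrightarrow>
        tensor_assoc R C C C (tensor_map R (tensor R C C) C (comult C) id (comult C c)) =
        tensor_map R C (tensor R C C) id (comult C) (comult C c)"
    and counit_left:
      "c \<in> carrier C \<Longrightarrow> tensor_lift C (\<lambda>(c1, c2). counit C c1 \<rightharpoonup>\<^bsub>C\<^esub> c2) (comult C c) = c"
    and counit_right:
      "c \<in> carrier C \<Longrightarrow> tensor_lift C (\<lambda>(c1, c2). c1 \<leftharpoonup>\<^bsub>C\<^esub> counit C c2) (comult C c) = c"

text \<open>The left dual \<open>*C\<close>. Its elements are extensional functions, so that equality of elements is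
  equality of functions on \<^term>\<open>carrier C\<close>.\<close>

definition left_dual ::
    "('r, 'x) ring_scheme \<Rightarrow> ('r, 'c, 'y) coring_scheme \<Rightarrow> ('r, 'c \<Rightarrow> 'r) bimod"
  where "left_dual R C =
    \<lparr>carrier = {f \<in> carrier C \<rightarrow>\<^sub>E carrier R.
       (\<forall>c\<in>carrier C. \<forall>d\<in>carrier C. f (c \<oplus>\<^bsub>C\<^esub> d) = f c \<oplus>\<^bsub>R\<^esub> f d) \<and>
       (\<forall>r\<in>carrier R. \<forall>c\<in>carrier C. f (r \<rightharpoonup>\<^bsub>C\<^esub> c) = r \<otimes>\<^bsub>R\<^esub> f c)},
     monoid.mult = (\<lambda>f g. \<lambda>c\<in>carrier C.
       tensor_lift R (\<lambda>(c1, c2). g (c1 \<leftharpoonup>\<^bsub>C\<^esub> f c2)) (comult C c)),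
     monoid.one = restrict (counit C) (carrier C),
     ring.zero = (\<lambda>c\<in>carrier C. \<zero>\<^bsub>R\<^esub>),
     add = (\<lambda>f g. \<lambda>c\<in>carrier C. f c \<oplus>\<^bsub>R\<^esub> g c),
     rsmult = (\<lambda>f r. \<lambda>c\<in>carrier C. f c \<otimes>\<^bsub>R\<^esub> r),
     lsmult = (\<lambda>r f. \<lambda>c\<in>carrier C. f (c \<leftharpoonup>\<^bsub>C\<^esub> r))\<rparr>"

locale measuring_left_pairing = A?: r_ring R A + C?: r_coring R C
  for R :: "('r, 'x) ring_scheme" (structure) and A :: "('r, 'a, 'y) bimod_scheme" (structure)
    and C :: "('r, 'c, 'z) coring_scheme" (structure)
    and \<kappa> :: "'a \<Rightarrow> 'c \<Rightarrow> 'r" +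
  assumes base_nontrivial: "\<one>\<^bsub>R\<^esub> \<noteq> \<zero>\<^bsub>R\<^esub>"
    and kappa_hom: "\<kappa> \<in> r_ring_hom R A (left_dual R C)"

text \<open>\<open>C\<close> as a right \<open>A\<close>-module: \<open>c \<leftharpoonup> a = \<Sum> c\<^sub>1 \<langle>a, c\<^sub>2\<rangle>\<close>.\<close>

definition pairing_module ::
    "('r, 'c, 'z) coring_scheme \<Rightarrow> ('a \<Rightarrow> 'c \<Rightarrow> 'r) \<Rightarrow> ('a, 'c) rmod"
  where "pairing_module C \<kappa> =
    \<lparr>carrier = carrier C, monoid.mult = undefined, monoid.one = undefined, ring.zero = \<zero>\<^bsub>C\<^esub>, add = add C,
     rsmult = (\<lambda>c a. tensor_lift C (\<lambda>(c1, c2). c1 \<leftharpoonup>\<^bsub>C\<^esub> \<kappa> a c2) (comult C c))\<rparr>"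


section \<open>Linear topologies\<close>

text \<open>The translation-invariant topology with \<open>\<B>\<close> as a base of neighbourhoods of \<open>0\<close>.\<close>

definition linear_topology :: "('a, 'x) ring_scheme \<Rightarrow> 'a set set \<Rightarrow> 'a topology"
  where "linear_topology A \<B> =
    topology (\<lambda>U. U \<subseteq> carrier A \<and> (\<forall>x\<in>U. \<exists>V\<in>\<B>. x <+\<^bsub>A\<^esub> V \<subseteq> U))"

lemma openin_linear_topology:
  assumes "\<And>V W. \<lbrakk>V \<in> \<B>; W \<in> \<B>\<rbrakk> \<Longrightarrow> \<exists>U\<in>\<B>. U \<subseteq> V \<inter> W"
  shows "openin (linear_topology A \<B>) U \<longleftrightarrow>
    U \<subseteq> carrier A \<and> (\<forall>x\<in>U. \<exists>V\<in>\<B>. x <+\<^bsub>A\<^esub> V \<subseteq> U)"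
proof -
  have mono: "x <+\<^bsub>A\<^esub> V \<subseteq> x <+\<^bsub>A\<^esub> W" if "V \<subseteq> W" for x V W
    using that by (auto simp: a_l_coset_def l_coset_def)
  have "istopology (\<lambda>U. U \<subseteq> carrier A \<and> (\<forall>x\<in>U. \<exists>V\<in>\<B>. x <+\<^bsub>A\<^esub> V \<subseteq> U))"
    unfolding istopology_def
  proof (intro conjI allI impI)
    fix S T
    assume S: "S \<subseteq> carrier A \<and> (\<forall>x\<in>S. \<exists>V\<in>\<B>. x <+\<^bsub>A\<^esub> V \<subseteq> S)"
      and T: "T \<subseteq> carrier A \<and> (\<forall>x\<in>T. \<exists>V\<in>\<B>. x <+\<^bsub>A\<^esub> V \<subseteq> T)"
    show "S \<inter> T \<subseteq> carrier A" using S by blast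
    show "\<forall>x\<in>S \<inter> T. \<exists>V\<in>\<B>. x <+\<^bsub>A\<^esub> V \<subseteq> S \<inter> T"
    proof
      fix x assume "x \<in> S \<inter> T"
      then obtain V W where VW: "V \<in> \<B>" "W \<in> \<B>" "x <+\<^bsub>A\<^esub> V \<subseteq> S" "x <+\<^bsub>A\<^esub> W \<subseteq> T"
        using S T by blast
      then obtain U where "U \<in> \<B>" "U \<subseteq> V \<inter> W" using assms by blast
      then show "\<exists>V\<in>\<B>. x <+\<^bsub>A\<^esub> V \<subseteq> S \<inter> T"
        using VW mono[of U V x] mono[of U W x] by blast
    qed
  next
    fix K assume K: "\<forall>S\<in>K. S \<subseteq> carrier A \<and> (\<forall>x\<in>S. \<exists>V\<in>\<B>. x <+\<^bsub>A\<^esub> V \<subseteq> S)"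
    then show "\<Union>K \<subseteq> carrier A" by blast
    show "\<forall>x\<in>\<Union>K. \<exists>V\<in>\<B>. x <+\<^bsub>A\<^esub> V \<subseteq> \<Union>K"
      using K by (meson Sup_upper UnionE subset_trans)
  qed
  then show ?thesis by (simp add: linear_topology_def topology_inverse')
qed

definition annihilating_perp ::
    "('r, 'x) ring_scheme \<Rightarrow> ('a, 'y) ring_scheme \<Rightarrow> ('a \<Rightarrow> 'c \<Rightarrow> 'r) \<Rightarrow> 'c set \<Rightarrow> 'a set"
  where "annihilating_perp R A \<kappa> F = {a \<in> carrier A. \<forall>c\<in>F. \<kappa> a c = \<zero>\<^bsub>R\<^esub>}"

definition annihilator :: "('a, 'x) ring_scheme \<Rightarrow> ('a, 'm, 'y) rmod_scheme \<Rightarrow> 'm set \<Rightarrow> 'a set"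
  where "annihilator A M F = {a \<in> carrier A. \<forall>m\<in>F. m \<leftharpoonup>\<^bsub>M\<^esub> a = \<zero>\<^bsub>M\<^esub>}"

definition weak_linear_topology ::
    "('r, 'x) ring_scheme \<Rightarrow> ('a, 'y) ring_scheme \<Rightarrow> ('r, 'c, 'z) coring_scheme
      \<Rightarrow> ('a \<Rightarrow> 'c \<Rightarrow> 'r) \<Rightarrow> 'a topology"
  where "weak_linear_topology R A C \<kappa> =
    linear_topology A {annihilating_perp R A \<kappa> F | F. finite F \<and> F \<subseteq> carrier C}"

definition adic_topology :: "('a, 'y) ring_scheme \<Rightarrow> ('a, 'm, 'z) rmod_scheme \<Rightarrow> 'a topology"
  where "adic_topology A M = linear_topology A {annihilator A M F | F. finite F \<and> F \<subseteq> carrier M}"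

definition topological_ring :: "('a, 'y) ring_scheme \<Rightarrow> 'a topology \<Rightarrow> bool"
  where "topological_ring A T \<longleftrightarrow> ring A \<and> topspace T = carrier A \<and>
    continuous_map (prod_topology T T) T (\<lambda>(a, b). a \<oplus>\<^bsub>A\<^esub> b) \<and>
    continuous_map T T (\<lambda>a. \<ominus>\<^bsub>A\<^esub> a) \<and>
    continuous_map (prod_topology T T) T (\<lambda>(a, b). a \<otimes>\<^bsub>A\<^esub> b)"

definition right_ideal :: "'a set \<Rightarrow> ('a, 'y) ring_scheme \<Rightarrow> bool"
  where "right_ideal I A \<longleftrightarrow> additive_subgroup I A \<and> (\<forall>i\<in>I. \<forall>a\<in>carrier A. i \<otimes>\<^bsub>A\<^esub> a \<in> I)"

definition nbhd_base_at :: "'a topology \<Rightarrow> 'a \<Rightarrow> 'a set set \<Rightarrow> bool"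
  where "nbhd_base_at T x \<B> \<longleftrightarrow>
    (\<forall>V\<in>\<B>. \<exists>U. openin T U \<and> x \<in> U \<and> U \<subseteq> V) \<and>
    (\<forall>U. openin T U \<and> x \<in> U \<longrightarrow> (\<exists>V\<in>\<B>. V \<subseteq> U))"

definition right_linear_topological_r_ring ::
    "('r, 'x) ring_scheme \<Rightarrow> ('r, 'a, 'y) bimod_scheme \<Rightarrow> 'a topology \<Rightarrow> bool"
  where "right_linear_topological_r_ring R A T \<longleftrightarrow> r_ring R A \<and> topological_ring A T \<and>
    (\<exists>\<B>. (\<forall>I\<in>\<B>. right_ideal I A) \<and> nbhd_base_at T \<zero>\<^bsub>A\<^esub> \<B>)"

definition discrete_module ::
    "('a, 'x) ring_scheme \<Rightarrow> 'a topology \<Rightarrow> ('a, 'm, 'y) rmod_scheme \<Rightarrow> bool"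
  where "discrete_module A T M \<longleftrightarrow> (\<forall>m\<in>carrier M. openin T (annihilator A M {m}))"


section \<open>Subgenerated modules\<close>

definition rsubmodule :: "('a, 'x) ring_scheme \<Rightarrow> 'm set \<Rightarrow> ('a, 'm, 'y) rmod_scheme \<Rightarrow> bool"
  where "rsubmodule A N M \<longleftrightarrow> additive_subgroup N M \<and> (\<forall>n\<in>N. \<forall>a\<in>carrier A. n \<leftharpoonup>\<^bsub>M\<^esub> a \<in> N)"

definition quotient_rmod :: "('a, 'm, 'y) rmod_scheme \<Rightarrow> 'm set \<Rightarrow> ('a, 'm set) rmod"
  where "quotient_rmod M K =
    \<lparr>carrier = a_rcosets\<^bsub>M\<^esub> K, monoid.mult = undefined, monoid.one = undefined,
     ring.zero = K, add = set_add M, rsmult = (\<lambda>X a. \<Union>x\<in>X. K +>\<^bsub>M\<^esub> (x \<leftharpoonup>\<^bsub>M\<^esub> a))\<rparr>"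

definition direct_sum_copies :: "'i set \<Rightarrow> ('a, 'm, 'y) rmod_scheme \<Rightarrow> ('a, 'i \<Rightarrow> 'm) rmod"
  where "direct_sum_copies I M =
    \<lparr>carrier = {f \<in> I \<rightarrow>\<^sub>E carrier M. finite {i \<in> I. f i \<noteq> \<zero>\<^bsub>M\<^esub>}},
     monoid.mult = undefined, monoid.one = undefined,
     ring.zero = (\<lambda>i\<in>I. \<zero>\<^bsub>M\<^esub>),
     add = (\<lambda>f g. \<lambda>i\<in>I. f i \<oplus>\<^bsub>M\<^esub> g i),
     rsmult = (\<lambda>f a. \<lambda>i\<in>I. f i \<leftharpoonup>\<^bsub>M\<^esub> a)\<rparr>"

definition rmod_iso ::
    "('a, 'x) ring_scheme \<Rightarrow> ('a, 'm, 'y) rmod_scheme \<Rightarrow> ('a, 'n, 'z) rmod_scheme \<Rightarrow> ('m \<Rightarrow> 'n) set"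
  where "rmod_iso A M N = {h. bij_betw h (carrier M) (carrier N) \<and>
    (\<forall>x\<in>carrier M. \<forall>y\<in>carrier M. h (x \<oplus>\<^bsub>M\<^esub> y) = h x \<oplus>\<^bsub>N\<^esub> h y) \<and>
    (\<forall>x\<in>carrier M. \<forall>a\<in>carrier A. h (x \<leftharpoonup>\<^bsub>M\<^esub> a) = h x \<leftharpoonup>\<^bsub>N\<^esub> a)}"

text \<open>\<open>M\<close> is isomorphic to a submodule of a quotient of a direct sum of copies of \<open>C\<close>. HOL cannot
  quantify over the type from which the index set is drawn, so it is a parameter. The type
  \<open>'m \<times> nat\<close> always suffices, where \<open>'m\<close> is the type of the elements of \<open>M\<close>: only the indices in
  the supports of chosen representatives of the images of elements of \<open>M\<close> matter.\<close>

definition subgenerated ::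
    "'i itself \<Rightarrow> ('a, 'x) ring_scheme \<Rightarrow> ('a, 'c, 'y) rmod_scheme \<Rightarrow> ('a, 'm, 'z) rmod_scheme \<Rightarrow> bool"
  where "subgenerated TYPE('i) A C M \<longleftrightarrow> (\<exists>(I :: 'i set) K N.
    rsubmodule A K (direct_sum_copies I C) \<and>
    rsubmodule A N (quotient_rmod (direct_sum_copies I C) K) \<and>
    rmod_iso A M ((quotient_rmod (direct_sum_copies I C) K)\<lparr>carrier := N\<rparr>) \<noteq> {})"

end

theory Submission
  imports Defs
begin

text \<open>The counit gives \<open>\<epsilon> (c \<leftharpoonup> a) = \<langle>a, c\<rangle>\<close>, so \<open>(0 : F) \<subseteq> F\<^sup>\<bottom>\<close>. Conversely, if
  \<open>\<Delta> c = \<Sum> c\<^sub>1 \<otimes> c\<^sub>2\<close> and \<open>a\<close> annihilates the finitely many \<open>c\<^sub>2\<close>, then \<open>c \<leftharpoonup> a = 0\<close>. Hence the two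
  topologies agree. The sets \<open>(0 : F)\<close> are right ideals, and \<open>a (0 : F a) \<subseteq> (0 : F)\<close> makes the
  multiplication continuous. A module is discrete if and only if the annihilator of each of its elements
  contains some \<open>(0 : F)\<close>. In a subquotient of \<open>C\<^sup>(\<^sup>I\<^sup>)\<close> one takes for \<open>F\<close> the components of
  a representative; conversely, given such sets, the cyclic submodules \<open>m A\<close> are quotients of
  submodules of finite powers of \<open>C\<close>.\<close>

section \<open>Tensor products\<close>

text \<open>That \<open>c \<leftharpoonup> a\<close> defines an A-module at all carries most of the
  formal weight. Tensors are cosets in a free abelian group, so \<Delta>(c) comes with no preferred
  expansion, and Sweedler calculations become equalities of additive maps compared on pure tensors.
  Associativity of the action lives on triple tensor products, which forces
  \<open>tensor R C C\<close> to be made a bimodule first: both of its scalar actions enter the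
  balancing conditions.

  In the converse for modules the cyclic submodules are not treated one at a time. Their
  presentations are summed: the free module on \<open>carrier M\<close> maps onto M and also into a
  direct sum of copies of C, and M is a subquotient of the latter because the kernel of the second
  map lies in that of the first. An index is an element m together with a position in a list of the
  finitely many elements of C whose joint annihilator kills m, whence the type
  \<open>'m \<times> nat\<close>.\<close>

lemma abelian_group_homI':
  fixes G :: "('g, 'x) ring_scheme" and H :: "('h, 'y) ring_scheme"
  assumes "abelian_group G" "abelian_group H"
    and "\<And>x. x \<in> carrier G \<Longrightarrow> f x \<in> carrier H"
    and "\<And>x y. \<lbrakk>x \<in> carrier G; y \<in> carrier G\<rbrakk> \<Longrightarrow> f (x \<oplus>\<^bsub>G\<^esub> y) = f x \<oplus>\<^bsub>H\<^esub> f y"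
  shows "abelian_group_hom G H f"
  using assms
  by (intro abelian_group_homI group_hom.intro group_hom_axioms.intro)
    (auto simp: hom_def abelian_group.a_group)

lemma abelian_group_hom_comp:
  assumes "abelian_group_hom G H f" "abelian_group_hom H L g"
  shows "abelian_group_hom G L (\<lambda>x. g (f x))"
proof -
  interpret f: abelian_group_hom G H f by fact
  interpret g: abelian_group_hom H L g by fact
  show ?thesis
    by (intro abelian_group_homI') (auto intro: assms[THEN abelian_group_hom.axioms(1)] assms[THEN abelian_group_hom.axioms(2)])
qed

lemma abelian_group_hom_add:
  assumes "abelian_group_hom G H f" "abelian_group_hom G H g"
  shows "abelian_group_hom G H (\<lambda>x. f x \<oplus>\<^bsub>H\<^esub> g x)"
proof -
  interpret f: abelian_group_hom G H f by fact
  interpret g: abelian_group_hom G H g by fact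
  show ?thesis
    by (intro abelian_group_homI')
      (auto intro: assms[THEN abelian_group_hom.axioms(1)] assms[THEN abelian_group_hom.axioms(2)] simp: f.H.add.m_ac)
qed

lemma (in abelian_group) minus_eq_zero_iff:
  assumes "x \<in> carrier G" "y \<in> carrier G"
  shows "x \<ominus> y = \<zero> \<longleftrightarrow> x = y"
  using assms by (metis add.inv_closed add.inv_equality minus_eq minus_minus r_neg)

text \<open>Commutative group structures arise on monoid records, such as factor groups or the
  additive monoid of another record. Only carrier, operation and unit have to agree to move them to
  a record whose multiplicative part is irrelevant.\<close>

lemma abelian_group_from_comm_group:
  assumes "comm_group Q" "carrier Q = carrier G" "monoid.mult Q = add G" "\<one>\<^bsub>Q\<^esub> = \<zero>\<^bsub>G\<^esub>"
  shows "abelian_group G"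
proof -
  interpret Q: comm_group Q by fact
  show ?thesis
  proof (rule abelian_groupI)
    fix x assume "x \<in> carrier G"
    then show "\<exists>y\<in>carrier G. y \<oplus>\<^bsub>G\<^esub> x = \<zero>\<^bsub>G\<^esub>"
      using Q.l_inv Q.inv_closed assms(2-4) by metis
  qed (use Q.m_closed Q.m_assoc Q.m_comm Q.l_one Q.one_closed assms(2-4) in \<open>simp_all\<close>)
qed

section \<open>Balanced maps and the universal property of the tensor product\<close>

definition balanced_map ::
    "('r, 'x) ring_scheme \<Rightarrow> ('r, 'm, 'y) bimod_scheme \<Rightarrow> ('r, 'n, 'z) bimod_scheme
      \<Rightarrow> ('g, 'w) ring_scheme \<Rightarrow> ('m \<times> 'n \<Rightarrow> 'g) \<Rightarrow> bool"
  where "balanced_map R M N G f \<longleftrightarrow> f \<in> carrier M \<times> carrier N \<rightarrow> carrier G \<and>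
    (\<forall>x\<in>carrier M. \<forall>x'\<in>carrier M. \<forall>y\<in>carrier N. f (x \<oplus>\<^bsub>M\<^esub> x', y) = f (x, y) \<oplus>\<^bsub>G\<^esub> f (x', y)) \<and>
    (\<forall>x\<in>carrier M. \<forall>y\<in>carrier N. \<forall>y'\<in>carrier N. f (x, y \<oplus>\<^bsub>N\<^esub> y') = f (x, y) \<oplus>\<^bsub>G\<^esub> f (x, y')) \<and>
    (\<forall>x\<in>carrier M. \<forall>r\<in>carrier R. \<forall>y\<in>carrier N. f (x \<leftharpoonup>\<^bsub>M\<^esub> r, y) = f (x, r \<rightharpoonup>\<^bsub>N\<^esub> y))"

lemma balanced_mapI:
  assumes "\<And>x y. \<lbrakk>x \<in> carrier M; y \<in> carrier N\<rbrakk> \<Longrightarrow> f (x, y) \<in> carrier G"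
    and "\<And>x x' y. \<lbrakk>x \<in> carrier M; x' \<in> carrier M; y \<in> carrier N\<rbrakk>
      \<Longrightarrow> f (x \<oplus>\<^bsub>M\<^esub> x', y) = f (x, y) \<oplus>\<^bsub>G\<^esub> f (x', y)"
    and "\<And>x y y'. \<lbrakk>x \<in> carrier M; y \<in> carrier N; y' \<in> carrier N\<rbrakk>
      \<Longrightarrow> f (x, y \<oplus>\<^bsub>N\<^esub> y') = f (x, y) \<oplus>\<^bsub>G\<^esub> f (x, y')"
    and "\<And>x r y. \<lbrakk>x \<in> carrier M; r \<in> carrier R; y \<in> carrier N\<rbrakk>
      \<Longrightarrow> f (x \<leftharpoonup>\<^bsub>M\<^esub> r, y) = f (x, r \<rightharpoonup>\<^bsub>N\<^esub> y)"
  shows "balanced_map R M N G f"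
  using assms unfolding balanced_map_def by auto

lemma carrier_tensor_free [simp]:
  "u \<in> carrier (tensor_free M N) \<longleftrightarrow> Poly_Mapping.keys u \<subseteq> carrier M \<times> carrier N"
  by (simp add: tensor_free_def)

lemma mult_tensor_free [simp]: "u \<otimes>\<^bsub>tensor_free M N\<^esub> v = u + v"
  by (simp add: tensor_free_def)

lemma comm_group_tensor_free: "comm_group (tensor_free M N)"
  by (simp add: tensor_free_def abelian_free_Abelian_group)

text \<open>The two factors are kept general because the results are instantiated three times: for C
  and C, and for the two ways of bracketing a triple tensor product of C.\<close>

locale bimodule_pair = M: bimodule R M + N: bimodule R N
  for R :: "('r, 'x) ring_scheme" and M :: "('r, 'm, 'y) bimod_scheme"
    and N :: "('r, 'n, 'z) bimod_scheme"
begin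

abbreviation "T \<equiv> tensor R M N"
abbreviation "pt \<equiv> pure_tensor R M N"
abbreviation "coset t \<equiv> tensor_kernel R M N #>\<^bsub>tensor_free M N\<^esub> t"

interpretation F: comm_group "tensor_free M N"
  by (rule comm_group_tensor_free)

lemma tensor_relators_subset: "tensor_relators R M N \<subseteq> carrier (tensor_free M N)"
proof -
  have "Poly_Mapping.keys (frag_of p - frag_of q) \<subseteq> {p, q}"
    "Poly_Mapping.keys (frag_of p - frag_of q - frag_of s) \<subseteq> {p, q, s}"
    for p q s :: "'m \<times> 'n"
    using keys_diff[of "frag_of p" "frag_of q"] keys_diff[of "frag_of p - frag_of q" "frag_of s"]
    by (auto simp: keys_frag_of)
  then show ?thesis
    unfolding tensor_relators_def by (fastforce simp: subset_iff)
qed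

lemma subgroup_tensor_kernel: "subgroup (tensor_kernel R M N) (tensor_free M N)"
  unfolding tensor_kernel_def using tensor_relators_subset by (rule F.generate_is_subgroup)

lemma abelian_group_tensor: "abelian_group T"
proof -
  have "comm_group (tensor_free M N Mod tensor_kernel R M N)"
    by (rule F.abelian_FactGroup[OF subgroup_tensor_kernel])
  then show ?thesis
    by (rule abelian_group_from_comm_group) (simp_all add: tensor_def FactGroup_def)
qed

sublocale T: abelian_group T
  by (rule abelian_group_tensor)

lemma coset_closed: "t \<in> carrier (tensor_free M N) \<Longrightarrow> coset t \<in> carrier T"
  using F.rcosetsI[of "tensor_kernel R M N" t] subgroup.subset[OF subgroup_tensor_kernel]
  by (simp add: tensor_def)

lemma tensor_cosetE:
  assumes "X \<in> carrier T"
  obtains t where "t \<in> carrier (tensor_free M N)" "X = coset t"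
  using assms by (auto simp: tensor_def RCOSETS_def)

lemma coset_add:
  assumes "s \<in> carrier (tensor_free M N)" "t \<in> carrier (tensor_free M N)"
  shows "coset (s + t) = coset s \<oplus>\<^bsub>T\<^esub> coset t"
proof -
  interpret normal "tensor_kernel R M N" "tensor_free M N"
    by (simp add: F.normal_iff_subgroup subgroup_tensor_kernel)
  show ?thesis using rcos_sum[OF assms] by (simp add: tensor_def)
qed

lemma coset_zero: "coset 0 = \<zero>\<^bsub>T\<^esub>"
  using F.coset_mult_one[OF subgroup.subset[OF subgroup_tensor_kernel]]
  by (simp add: tensor_def tensor_free_def)

lemma coset_diff:
  assumes "s \<in> carrier (tensor_free M N)" "t \<in> carrier (tensor_free M N)"
  shows "coset (s - t) = coset s \<ominus>\<^bsub>T\<^esub> coset t"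
proof -
  have d: "s - t \<in> carrier (tensor_free M N)"
    using assms keys_diff[of s t] by auto
  have "coset (s - t) \<oplus>\<^bsub>T\<^esub> coset t = coset s"
    using coset_add[OF d assms(2)] by simp
  then show ?thesis
    using coset_closed[OF d] coset_closed[OF assms(2)]
    by (metis T.add.inv_closed T.add.m_assoc T.minus_eq T.r_neg T.r_zero)
qed

lemma pure_tensor_closed [simp, intro]:
  "\<lbrakk>x \<in> carrier M; y \<in> carrier N\<rbrakk> \<Longrightarrow> pt x y \<in> carrier T"
  unfolding pure_tensor_def by (rule coset_closed) simp

text \<open>Pure tensors generate the group. Closure under differences takes care of negative
  coefficients, so that no integer multiples occur; this shape is inherited from
  \<open>free_Abelian_group_induct\<close>.\<close>

lemma tensor_induct [consumes 1, case_names zero pure diff]: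
  assumes "X \<in> carrier T" and "P \<zero>\<^bsub>T\<^esub>"
    and pure: "\<And>x y. \<lbrakk>x \<in> carrier M; y \<in> carrier N\<rbrakk> \<Longrightarrow> P (pt x y)"
    and diff: "\<And>X Y. \<lbrakk>X \<in> carrier T; Y \<in> carrier T; P X; P Y\<rbrakk> \<Longrightarrow> P (X \<ominus>\<^bsub>T\<^esub> Y)"
  shows "P X"
proof -
  obtain t where t: "Poly_Mapping.keys t \<subseteq> carrier M \<times> carrier N" "X = coset t"
    using assms(1) by (auto elim!: tensor_cosetE)
  have "P (coset t)"
    using t(1)
  proof (rule free_Abelian_group_induct)
    show "P (coset 0)" using assms(2) by (simp add: coset_zero)
    show "P (coset (x - y))" if "Poly_Mapping.keys x \<subseteq> carrier M \<times> carrier N"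
      "Poly_Mapping.keys y \<subseteq> carrier M \<times> carrier N" "P (coset x)" "P (coset y)" for x y
      using that by (simp add: coset_diff coset_closed diff)
    show "P (coset (frag_of p))" if "p \<in> carrier M \<times> carrier N" for p
      using that pure by (cases p) (auto simp: pure_tensor_def)
  qed
  then show ?thesis using t by simp
qed

text \<open>The uniqueness half of the universal property. It is the substitute for computing with
  Sweedler sums: both sides of an identity are exhibited as additive maps and then compared on pure
  tensors.\<close>

lemma tensor_hom_eqI:
  assumes "abelian_group_hom T G f" "abelian_group_hom T G g"
    and "\<And>x y. \<lbrakk>x \<in> carrier M; y \<in> carrier N\<rbrakk> \<Longrightarrow> f (pt x y) = g (pt x y)"
    and "X \<in> carrier T"
  shows "f X = g X"
proof -
  interpret f: abelian_group_hom T G f by fact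
  interpret g: abelian_group_hom T G g by fact
  show ?thesis
    using assms(4)
    by (induction X rule: tensor_induct) (auto simp: assms(3) T.minus_eq)
qed

lemma tensor_lift_coset':
  assumes "abelian_group G" "balanced_map R M N G f" "t \<in> carrier (tensor_free M N)"
  shows "tensor_lift G f (coset t) = frag_eval G f t"
  using assms M.bimodule_axioms N.bimodule_axioms
  by (intro tensor_lift_coset) (auto simp: balanced_map_def)

lemma tensor_lift_pure:
  assumes "abelian_group G" "balanced_map R M N G f" "x \<in> carrier M" "y \<in> carrier N"
  shows "tensor_lift G f (pt x y) = f (x, y)"
proof -
  have "f (x, y) \<in> carrier G" using assms by (auto simp: balanced_map_def)
  then show ?thesis
    using assms by (simp add: pure_tensor_def tensor_lift_coset' frag_eval_of)
qed

text \<open>Together with \<open>tensor_lift_pure\<close> this is the existence half of the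
  universal property.\<close>

lemma tensor_lift_hom:
  assumes G: "abelian_group G" and f: "balanced_map R M N G f"
  shows "abelian_group_hom T G (tensor_lift G f)"
proof (rule abelian_group_homI'[OF abelian_group_tensor G])
  interpret G: abelian_group G by fact
  have fS: "f \<in> carrier M \<times> carrier N \<rightarrow> carrier G" using f by (simp add: balanced_map_def)
  fix X assume "X \<in> carrier T"
  then obtain s where s: "s \<in> carrier (tensor_free M N)" "X = coset s" by (rule tensor_cosetE)
  then show "tensor_lift G f X \<in> carrier G"
    using fS by (auto simp: tensor_lift_coset'[OF G f] frag_eval_def subset_iff
        intro!: G.finsum_closed G.add.int_pow_closed)
  fix Y assume "Y \<in> carrier T"
  then obtain t where t: "t \<in> carrier (tensor_free M N)" "Y = coset t" by (rule tensor_cosetE)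
  have "s + t \<in> carrier (tensor_free M N)" using s t keys_add[of s t] by auto
  then show "tensor_lift G f (X \<oplus>\<^bsub>T\<^esub> Y) = tensor_lift G f X \<oplus>\<^bsub>G\<^esub> tensor_lift G f Y"
    using s t by (simp add: coset_add[symmetric] tensor_lift_coset'[OF G f] frag_eval_add[OF G fS])
qed

lemma coset_relator:
  assumes "u \<in> tensor_relators R M N"
  shows "coset u = \<zero>\<^bsub>T\<^esub>"
proof -
  have "u \<in> tensor_kernel R M N"
    unfolding tensor_kernel_def using assms by (rule generate.incl)
  then show ?thesis
    using F.coset_join2[OF _ subgroup_tensor_kernel] subgroup.mem_carrier[OF subgroup_tensor_kernel]
    by (simp add: tensor_def)
qed

lemma pure_tensor_balanced: "balanced_map R M N T (\<lambda>(x, y). pt x y)"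
proof -
  \<comment> \<open>A vanishing relator has the shape X - Y - Z = 0 in the tensor product; this
    turns it into the additive law X = Y + Z.\<close>
  have 1: "X = Y \<oplus>\<^bsub>T\<^esub> Z" if "X \<ominus>\<^bsub>T\<^esub> Y \<ominus>\<^bsub>T\<^esub> Z = \<zero>\<^bsub>T\<^esub>"
    "X \<in> carrier T" "Y \<in> carrier T" "Z \<in> carrier T" for X Y Z
    using that
    by (metis T.a_assoc T.a_comm T.add.inv_closed T.add.inv_solve_right T.l_zero T.minus_closed T.minus_eq)
  have dc: "frag_of p - frag_of q \<in> carrier (tensor_free M N)"
    if "p \<in> carrier M \<times> carrier N" "q \<in> carrier M \<times> carrier N" for p q
    using that keys_diff[of "frag_of p" "frag_of q"] by (auto simp: keys_frag_of)
  have fc: "frag_of p \<in> carrier (tensor_free M N)" if "p \<in> carrier M \<times> carrier N" for p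
    using that by simp
  show ?thesis
  proof (rule balanced_mapI, goal_cases)
    case (1 x y)
    then show ?case by simp
  next
    case (2 x x' y)
    then have "coset (frag_of (x \<oplus>\<^bsub>M\<^esub> x', y) - frag_of (x, y) - frag_of (x', y)) = \<zero>\<^bsub>T\<^esub>"
      by (intro coset_relator) (auto simp: tensor_relators_def)
    then show ?case
      using 2 1[of "pt (x \<oplus>\<^bsub>M\<^esub> x') y" "pt x y" "pt x' y"] dc fc
      by (simp add: coset_diff pure_tensor_def[symmetric] del: carrier_tensor_free)
  next
    case (3 x y y')
    then have "coset (frag_of (x, y \<oplus>\<^bsub>N\<^esub> y') - frag_of (x, y) - frag_of (x, y')) = \<zero>\<^bsub>T\<^esub>"
      by (intro coset_relator) (auto simp: tensor_relators_def)
    then show ?case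
      using 3 1[of "pt x (y \<oplus>\<^bsub>N\<^esub> y')" "pt x y" "pt x y'"] dc fc
      by (simp add: coset_diff pure_tensor_def[symmetric] del: carrier_tensor_free)
  next
    case (4 x r y)
    then have "coset (frag_of (x \<leftharpoonup>\<^bsub>M\<^esub> r, y) - frag_of (x, r \<rightharpoonup>\<^bsub>N\<^esub> y)) = \<zero>\<^bsub>T\<^esub>"
      by (intro coset_relator) (auto simp: tensor_relators_def)
    then show ?case
      using 4 by (simp add: coset_diff pure_tensor_def[symmetric] T.minus_eq_zero_iff)
  qed
qed

lemma pure_tensor_add_left:
  "\<lbrakk>x \<in> carrier M; x' \<in> carrier M; y \<in> carrier N\<rbrakk> \<Longrightarrow> pt (x \<oplus>\<^bsub>M\<^esub> x') y = pt x y \<oplus>\<^bsub>T\<^esub> pt x' y"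
  using pure_tensor_balanced by (auto simp: balanced_map_def)

lemma pure_tensor_add_right:
  "\<lbrakk>x \<in> carrier M; y \<in> carrier N; y' \<in> carrier N\<rbrakk> \<Longrightarrow> pt x (y \<oplus>\<^bsub>N\<^esub> y') = pt x y \<oplus>\<^bsub>T\<^esub> pt x y'"
  using pure_tensor_balanced by (auto simp: balanced_map_def)

lemma pure_tensor_middle:
  "\<lbrakk>x \<in> carrier M; r \<in> carrier R; y \<in> carrier N\<rbrakk> \<Longrightarrow> pt (x \<leftharpoonup>\<^bsub>M\<^esub> r) y = pt x (r \<rightharpoonup>\<^bsub>N\<^esub> y)"
  using pure_tensor_balanced by (auto simp: balanced_map_def)

text \<open>The scalar actions of \<open>tensor\<close> are unions of cosets over all
  representatives t of X. Such a union is a single coset because the lift of \<psi> depends on X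
  only and equals the coset of \<open>frag_extend \<phi> t\<close> for every t in X. This identifies
  the actions with lifts of balanced maps.\<close>

lemma Union_coset_frag_extend:
  assumes \<psi>: "balanced_map R M N T \<psi>"
    and \<phi>: "\<And>p. p \<in> carrier M \<times> carrier N \<Longrightarrow> \<phi> p \<in> carrier (tensor_free M N)"
      "\<And>p. p \<in> carrier M \<times> carrier N \<Longrightarrow> coset (\<phi> p) = \<psi> p"
    and X: "X \<in> carrier T"
  shows "(\<Union>t\<in>X. coset (frag_extend \<phi> t)) = tensor_lift T \<psi> X"
proof -
  interpret h: abelian_group_hom T T "tensor_lift T \<psi>"
    by (rule tensor_lift_hom[OF abelian_group_tensor \<psi>])
  have *: "frag_extend \<phi> t \<in> carrier (tensor_free M N) \<and> tensor_lift T \<psi> (coset t) = coset (frag_extend \<phi> t)"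
    if "t \<in> carrier (tensor_free M N)" for t
  proof (rule free_Abelian_group_induct[where P = "\<lambda>t. frag_extend \<phi> t \<in> carrier (tensor_free M N) \<and>
        tensor_lift T \<psi> (coset t) = coset (frag_extend \<phi> t)"])
    show "Poly_Mapping.keys t \<subseteq> carrier M \<times> carrier N" using that by simp
    show "frag_extend \<phi> 0 \<in> carrier (tensor_free M N) \<and>
        tensor_lift T \<psi> (coset 0) = coset (frag_extend \<phi> 0)"
      by (simp add: coset_zero)
  next
    fix x y :: "'m \<times> 'n \<Rightarrow>\<^sub>0 int"
    assume xy: "Poly_Mapping.keys x \<subseteq> carrier M \<times> carrier N"
        "Poly_Mapping.keys y \<subseteq> carrier M \<times> carrier N"
      "frag_extend \<phi> x \<in> carrier (tensor_free M N) \<and>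
        tensor_lift T \<psi> (coset x) = coset (frag_extend \<phi> x)"
      "frag_extend \<phi> y \<in> carrier (tensor_free M N) \<and>
        tensor_lift T \<psi> (coset y) = coset (frag_extend \<phi> y)"
    then have "frag_extend \<phi> x - frag_extend \<phi> y \<in> carrier (tensor_free M N)"
      using keys_diff[of "frag_extend \<phi> x" "frag_extend \<phi> y"] by auto
    moreover have "tensor_lift T \<psi> (coset x \<ominus>\<^bsub>T\<^esub> coset y)
        = tensor_lift T \<psi> (coset x) \<ominus>\<^bsub>T\<^esub> tensor_lift T \<psi> (coset y)"
      using xy by (simp add: T.minus_eq coset_closed)
    ultimately show "frag_extend \<phi> (x - y) \<in> carrier (tensor_free M N) \<and>
        tensor_lift T \<psi> (coset (x - y)) = coset (frag_extend \<phi> (x - y))"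
      using xy by (simp add: frag_extend_diff coset_diff)
  next
    fix p assume p: "p \<in> carrier M \<times> carrier N"
    then have "tensor_lift T \<psi> (coset (frag_of p)) = \<psi> p"
      using tensor_lift_pure[OF abelian_group_tensor \<psi>, of "fst p" "snd p"]
      by (auto simp: pure_tensor_def)
    then show "frag_extend \<phi> (frag_of p) \<in> carrier (tensor_free M N) \<and>
        tensor_lift T \<psi> (coset (frag_of p)) = coset (frag_extend \<phi> (frag_of p))"
      using p \<phi> by simp
  qed
  obtain s where s: "s \<in> carrier (tensor_free M N)" "X = coset s"
    using X by (rule tensor_cosetE)
  have "coset (frag_extend \<phi> t) = tensor_lift T \<psi> X" if "t \<in> X" for t
  proof -
    have "coset s = coset t"
      using that s subgroup_tensor_kernel by (intro F.repr_independence) auto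
    moreover have "t \<in> carrier (tensor_free M N)"
      using that s F.r_coset_subset_G[OF subgroup.subset[OF subgroup_tensor_kernel] s(1)] by blast
    ultimately show ?thesis using * s by simp
  qed
  moreover have "s \<in> X" using s F.rcos_self[OF s(1) subgroup_tensor_kernel] by simp
  ultimately show ?thesis by (auto intro!: UN_constant_eq)
qed

text \<open>Once the action of r is recognised as the lift of
  \<open>x \<otimes> y \<mapsto> r x \<otimes> y\<close>, additivity and the value on pure tensors
  come from the universal property. That this map is balanced uses the compatibility of the two
  actions on M.\<close>

lemma lsmult_tensor:
  assumes r: "r \<in> carrier R"
  shows "abelian_group_hom T T (\<lambda>X. r \<rightharpoonup>\<^bsub>T\<^esub> X)"
    and "\<lbrakk>x \<in> carrier M; y \<in> carrier N\<rbrakk> \<Longrightarrow> r \<rightharpoonup>\<^bsub>T\<^esub> pt x y = pt (r \<rightharpoonup>\<^bsub>M\<^esub> x) y"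
proof -
  let ?\<psi> = "\<lambda>(x, y). pt (r \<rightharpoonup>\<^bsub>M\<^esub> x) y"
  have bal: "balanced_map R M N T ?\<psi>"
    using r by (intro balanced_mapI)
      (simp_all add: pure_tensor_add_left pure_tensor_add_right M.lsmult_r_distr
        pure_tensor_middle M.lsmult_rsmult_assoc[symmetric])
  have eq: "r \<rightharpoonup>\<^bsub>T\<^esub> X = tensor_lift T ?\<psi> X" if "X \<in> carrier T" for X
  proof -
    have "(\<Union>t\<in>X. coset (frag_extend (\<lambda>(x, y). frag_of (r \<rightharpoonup>\<^bsub>M\<^esub> x, y)) t)) = tensor_lift T ?\<psi> X"
      using r by (intro Union_coset_frag_extend[OF bal _ _ that]) (auto simp: pure_tensor_def)
    then show ?thesis by (simp add: tensor_def)
  qed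
  interpret h: abelian_group_hom T T "tensor_lift T ?\<psi>"
    by (rule tensor_lift_hom[OF abelian_group_tensor bal])
  show "abelian_group_hom T T (\<lambda>X. r \<rightharpoonup>\<^bsub>T\<^esub> X)"
    by (rule abelian_group_homI') (simp_all add: eq abelian_group_tensor)
  show "r \<rightharpoonup>\<^bsub>T\<^esub> pt x y = pt (r \<rightharpoonup>\<^bsub>M\<^esub> x) y" if "x \<in> carrier M" "y \<in> carrier N"
    using that tensor_lift_pure[OF abelian_group_tensor bal] by (simp add: eq)
qed

lemma rsmult_tensor:
  assumes r: "r \<in> carrier R"
  shows "abelian_group_hom T T (\<lambda>X. X \<leftharpoonup>\<^bsub>T\<^esub> r)"
    and "\<lbrakk>x \<in> carrier M; y \<in> carrier N\<rbrakk> \<Longrightarrow> pt x y \<leftharpoonup>\<^bsub>T\<^esub> r = pt x (y \<leftharpoonup>\<^bsub>N\<^esub> r)"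
proof -
  let ?\<psi> = "\<lambda>(x, y). pt x (y \<leftharpoonup>\<^bsub>N\<^esub> r)"
  have bal: "balanced_map R M N T ?\<psi>"
    using r by (intro balanced_mapI)
      (simp_all add: pure_tensor_add_left pure_tensor_add_right N.rsmult_l_distr
        pure_tensor_middle N.lsmult_rsmult_assoc)
  have eq: "X \<leftharpoonup>\<^bsub>T\<^esub> r = tensor_lift T ?\<psi> X" if "X \<in> carrier T" for X
  proof -
    have "(\<Union>t\<in>X. coset (frag_extend (\<lambda>(x, y). frag_of (x, y \<leftharpoonup>\<^bsub>N\<^esub> r)) t)) = tensor_lift T ?\<psi> X"
      using r by (intro Union_coset_frag_extend[OF bal _ _ that]) (auto simp: pure_tensor_def)
    then show ?thesis by (simp add: tensor_def)
  qed
  interpret h: abelian_group_hom T T "tensor_lift T ?\<psi>"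
    by (rule tensor_lift_hom[OF abelian_group_tensor bal])
  show "abelian_group_hom T T (\<lambda>X. X \<leftharpoonup>\<^bsub>T\<^esub> r)"
    by (rule abelian_group_homI') (simp_all add: eq abelian_group_tensor)
  show "pt x y \<leftharpoonup>\<^bsub>T\<^esub> r = pt x (y \<leftharpoonup>\<^bsub>N\<^esub> r)" if "x \<in> carrier M" "y \<in> carrier N"
    using that tensor_lift_pure[OF abelian_group_tensor bal] by (simp add: eq)
qed

text \<open>For fixed scalars, each axiom beyond closure and additivity in X equates two additive
  endomorphisms of the tensor product, so it need only be checked on pure tensors, where it is an
  axiom of M or of N or, for the compatibility of the two actions, immediate.\<close>

lemma bimodule_tensor: "bimodule R T"
proof -
  note l = lsmult_tensor and r = rsmult_tensor
  note lc = abelian_group_hom.hom_closed[OF l(1)] and rc = abelian_group_hom.hom_closed[OF r(1)]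
  note la = abelian_group_hom.hom_add[OF l(1)] and ra = abelian_group_hom.hom_add[OF r(1)]
  have id: "abelian_group_hom T T (\<lambda>X. X)"
    by (rule abelian_group_homI') (simp_all add: abelian_group_tensor)
  show ?thesis
  proof (unfold_locales, goal_cases)
    case (3 X r s)
    show ?case
      by (rule tensor_hom_eqI[OF r(1) abelian_group_hom_add[OF r(1) r(1)]])
        (use 3 in \<open>simp_all add: r(2) N.rsmult_r_distr pure_tensor_add_right\<close>)
  next
    case (4 X r s)
    show ?case
      by (rule tensor_hom_eqI[OF r(1) abelian_group_hom_comp[OF r(1) r(1)]])
        (use 4 in \<open>simp_all add: r(2) N.rsmult_assoc\<close>)
  next
    case (5 X)
    show ?case
      by (rule tensor_hom_eqI[OF r(1) id]) (use 5 in \<open>simp_all add: r(2)\<close>)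
  next
    case (8 r s X)
    show ?case
      by (rule tensor_hom_eqI[OF l(1) abelian_group_hom_add[OF l(1) l(1)]])
        (use 8 in \<open>simp_all add: l(2) M.lsmult_l_distr pure_tensor_add_left\<close>)
  next
    case (9 r s X)
    show ?case
      by (rule tensor_hom_eqI[OF l(1) abelian_group_hom_comp[OF l(1) l(1)]])
        (use 9 in \<open>simp_all add: l(2) M.lsmult_assoc\<close>)
  next
    case (10 X)
    show ?case
      by (rule tensor_hom_eqI[OF l(1) id]) (use 10 in \<open>simp_all add: l(2)\<close>)
  next
    case (11 r X s)
    show ?case
      by (rule tensor_hom_eqI[OF abelian_group_hom_comp[OF l(1) r(1)] abelian_group_hom_comp[OF r(1) l(1)]])
        (use 11 in \<open>simp_all add: l(2) r(2)\<close>)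
  qed (simp_all add: lc rc la ra)
qed

end


section \<open>The module structure of a measuring pairing\<close>

context right_module
begin

lemma rsmult_hom_left: "x \<in> carrier M \<Longrightarrow> abelian_group_hom R M (\<lambda>r. x \<leftharpoonup>\<^bsub>M\<^esub> r)"
  by (rule abelian_group_homI')
    (simp_all add: rsmult_r_distr R.is_abelian_group M.abelian_group_axioms)

lemma rsmult_hom_right: "r \<in> carrier R \<Longrightarrow> abelian_group_hom M M (\<lambda>x. x \<leftharpoonup>\<^bsub>M\<^esub> r)"
  by (rule abelian_group_homI') (simp_all add: rsmult_l_distr M.abelian_group_axioms)

lemma rsmult_zero_right [simp]: "x \<in> carrier M \<Longrightarrow> x \<leftharpoonup>\<^bsub>M\<^esub> \<zero>\<^bsub>R\<^esub> = \<zero>\<^bsub>M\<^esub>"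
  using abelian_group_hom.hom_zero[OF rsmult_hom_left] .

lemma rsmult_zero_left [simp]: "r \<in> carrier R \<Longrightarrow> \<zero>\<^bsub>M\<^esub> \<leftharpoonup>\<^bsub>M\<^esub> r = \<zero>\<^bsub>M\<^esub>"
  using abelian_group_hom.hom_zero[OF rsmult_hom_right] .

lemma rsmult_minus_right:
  "\<lbrakk>x \<in> carrier M; r \<in> carrier R\<rbrakk> \<Longrightarrow> x \<leftharpoonup>\<^bsub>M\<^esub> (\<ominus>\<^bsub>R\<^esub> r) = \<ominus>\<^bsub>M\<^esub> (x \<leftharpoonup>\<^bsub>M\<^esub> r)"
  using abelian_group_hom.hom_a_inv[OF rsmult_hom_left] .

end

section \<open>The structure maps of a coring as additive maps\<close>

context r_coring
begin

interpretation CC: bimodule_pair R C C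
  by (intro bimodule_pair.intro bimodule_axioms)

lemma comult_group_hom: "abelian_group_hom C (tensor R C C) (comult C)"
  using comult_hom
  by (intro abelian_group_homI')
    (auto simp: bimodule_hom_def M.abelian_group_axioms CC.abelian_group_tensor)

lemma comult_closed [simp, intro]: "c \<in> carrier C \<Longrightarrow> comult C c \<in> carrier (tensor R C C)"
  using comult_hom by (auto simp: bimodule_hom_def)

lemma comult_lsmult:
  "\<lbrakk>r \<in> carrier R; c \<in> carrier C\<rbrakk> \<Longrightarrow> comult C (r \<rightharpoonup>\<^bsub>C\<^esub> c) = r \<rightharpoonup>\<^bsub>tensor R C C\<^esub> comult C c"
  using comult_hom by (auto simp: bimodule_hom_def)

lemma comult_rsmult:
  "\<lbrakk>r \<in> carrier R; c \<in> carrier C\<rbrakk> \<Longrightarrow> comult C (c \<leftharpoonup>\<^bsub>C\<^esub> r) = comult C c \<leftharpoonup>\<^bsub>tensor R C C\<^esub> r"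
  using comult_hom by (auto simp: bimodule_hom_def)

lemma counit_group_hom: "abelian_group_hom C R (counit C)"
  using counit_hom
  by (intro abelian_group_homI')
    (auto simp: bimodule_hom_def regular_bimod_def M.abelian_group_axioms R.is_abelian_group)

lemma counit_closed [simp, intro]: "c \<in> carrier C \<Longrightarrow> counit C c \<in> carrier R"
  using abelian_group_hom.hom_closed[OF counit_group_hom] .

lemma counit_lsmult:
  "\<lbrakk>r \<in> carrier R; c \<in> carrier C\<rbrakk> \<Longrightarrow> counit C (r \<rightharpoonup>\<^bsub>C\<^esub> c) = r \<otimes>\<^bsub>R\<^esub> counit C c"
  using counit_hom by (auto simp: bimodule_hom_def regular_bimod_def)

lemma counit_rsmult:
  "\<lbrakk>r \<in> carrier R; c \<in> carrier C\<rbrakk> \<Longrightarrow> counit C (c \<leftharpoonup>\<^bsub>C\<^esub> r) = counit C c \<otimes>\<^bsub>R\<^esub> r"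
  using counit_hom by (auto simp: bimodule_hom_def regular_bimod_def)

text \<open>Left linearity of g is exactly what moves a scalar across the tensor sign: (c1 r) g(c2)
  = c1 (r g(c2)) = c1 g(r c2). It is applied to the counit and to the functionals
  \<open>\<kappa> a\<close>.\<close>

lemma balanced_functional:
  assumes "abelian_group_hom C R g"
    and "\<And>r c. \<lbrakk>r \<in> carrier R; c \<in> carrier C\<rbrakk> \<Longrightarrow> g (r \<rightharpoonup>\<^bsub>C\<^esub> c) = r \<otimes>\<^bsub>R\<^esub> g c"
  shows "balanced_map R C C C (\<lambda>(c1, c2). c1 \<leftharpoonup>\<^bsub>C\<^esub> g c2)"
proof -
  interpret g: abelian_group_hom C R g by fact
  show ?thesis
    by (rule balanced_mapI) (simp_all add: rsmult_l_distr rsmult_r_distr rsmult_assoc assms(2))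
qed

end

section \<open>The right action of A on C\<close>

context measuring_left_pairing
begin

interpretation CC: bimodule_pair R C C
  by (intro bimodule_pair.intro C.bimodule_axioms)

interpretation L: bimodule_pair R "tensor R C C" C
  by (intro bimodule_pair.intro C.bimodule_axioms CC.bimodule_tensor)

interpretation Rt: bimodule_pair R C "tensor R C C"
  by (intro bimodule_pair.intro C.bimodule_axioms CC.bimodule_tensor)

abbreviation act :: "'c \<Rightarrow> 'a \<Rightarrow> 'c"
  where "act c a \<equiv> c \<leftharpoonup>\<^bsub>pairing_module C \<kappa>\<^esub> a"

abbreviation pair_map :: "'a \<Rightarrow> 'c \<times> 'c \<Rightarrow> 'c"
  where "pair_map a \<equiv> \<lambda>(c1, c2). c1 \<leftharpoonup>\<^bsub>C\<^esub> \<kappa> a c2"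

lemma act_def: "act c a = tensor_lift C (pair_map a) (comult C c)"
  by (simp add: pairing_module_def)

lemma kappa_dual: "a \<in> carrier A \<Longrightarrow> \<kappa> a \<in> carrier (left_dual R C)"
  using kappa_hom by (auto simp: r_ring_hom_def bimodule_hom_def)

lemma kappa_group_hom: "a \<in> carrier A \<Longrightarrow> abelian_group_hom C R (\<kappa> a)"
  using kappa_dual[of a]
  by (intro abelian_group_homI')
    (auto simp: left_dual_def C.counit_group_hom[THEN abelian_group_hom.axioms(1)] C.counit_group_hom[THEN abelian_group_hom.axioms(2)])

lemma kappa_closed [simp, intro]: "\<lbrakk>a \<in> carrier A; c \<in> carrier C\<rbrakk> \<Longrightarrow> \<kappa> a c \<in> carrier R"
  using abelian_group_hom.hom_closed[OF kappa_group_hom] .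

lemma kappa_lsmult:
  "\<lbrakk>a \<in> carrier A; r \<in> carrier R; c \<in> carrier C\<rbrakk> \<Longrightarrow> \<kappa> a (r \<rightharpoonup>\<^bsub>C\<^esub> c) = r \<otimes>\<^bsub>R\<^esub> \<kappa> a c"
  using kappa_dual[of a] by (simp add: left_dual_def)

lemma kappa_add:
  "\<lbrakk>a \<in> carrier A; b \<in> carrier A; c \<in> carrier C\<rbrakk> \<Longrightarrow> \<kappa> (a \<oplus>\<^bsub>A\<^esub> b) c = \<kappa> a c \<oplus>\<^bsub>R\<^esub> \<kappa> b c"
  using kappa_hom by (simp add: r_ring_hom_def bimodule_hom_def left_dual_def)

lemma kappa_mult:
  "\<lbrakk>a \<in> carrier A; b \<in> carrier A; c \<in> carrier C\<rbrakk> \<Longrightarrow>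
    \<kappa> (a \<otimes>\<^bsub>A\<^esub> b) c = tensor_lift R (\<lambda>(c1, c2). \<kappa> b (c1 \<leftharpoonup>\<^bsub>C\<^esub> \<kappa> a c2)) (comult C c)"
  using kappa_hom by (simp add: r_ring_hom_def ring_hom_def left_dual_def)

lemma kappa_one: "c \<in> carrier C \<Longrightarrow> \<kappa> \<one>\<^bsub>A\<^esub> c = counit C c"
  using kappa_hom by (simp add: r_ring_hom_def ring_hom_def left_dual_def)

lemma pair_map_balanced: "a \<in> carrier A \<Longrightarrow> balanced_map R C C C (pair_map a)"
  by (intro C.balanced_functional kappa_group_hom kappa_lsmult)

lemmas pair_lift_hom = CC.tensor_lift_hom[OF C.M.abelian_group_axioms pair_map_balanced]
lemmas pair_lift_pure = CC.tensor_lift_pure[OF C.M.abelian_group_axioms pair_map_balanced]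

lemma act_group_hom: "a \<in> carrier A \<Longrightarrow> abelian_group_hom C C (\<lambda>c. act c a)"
  unfolding act_def by (rule abelian_group_hom_comp[OF C.comult_group_hom pair_lift_hom])

lemma act_add:
  assumes "a \<in> carrier A" "b \<in> carrier A" "c \<in> carrier C"
  shows "act c (a \<oplus>\<^bsub>A\<^esub> b) = act c a \<oplus>\<^bsub>C\<^esub> act c b"
  unfolding act_def
  by (rule CC.tensor_hom_eqI[OF pair_lift_hom abelian_group_hom_add[OF pair_lift_hom pair_lift_hom]])
    (use assms in \<open>simp_all add: pair_lift_pure kappa_add C.rsmult_r_distr\<close>)

text \<open>Since \<kappa> preserves unities, the functional paired with 1 is the counit, and the
  claim becomes the right counit law.\<close>

lemma act_one:
  assumes c: "c \<in> carrier C"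
  shows "act c \<one>\<^bsub>A\<^esub> = c"
proof -
  have bal: "balanced_map R C C C (\<lambda>(c1, c2). c1 \<leftharpoonup>\<^bsub>C\<^esub> counit C c2)"
    by (intro C.balanced_functional C.counit_group_hom C.counit_lsmult)
  have "act c \<one>\<^bsub>A\<^esub> = tensor_lift C (\<lambda>(c1, c2). c1 \<leftharpoonup>\<^bsub>C\<^esub> counit C c2) (comult C c)"
    unfolding act_def
    by (rule CC.tensor_hom_eqI[OF pair_lift_hom CC.tensor_lift_hom[OF C.M.abelian_group_axioms bal]])
      (use c in \<open>simp_all add: pair_lift_pure kappa_one CC.tensor_lift_pure[OF C.M.abelian_group_axioms bal]\<close>)
  then show ?thesis using C.counit_right[OF c] by simp
qed

text \<open>Right linearity of \<epsilon> and left linearity of \<langle>a, -\<rangle> give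
  \<epsilon>(c1 \<langle>a, c2\<rangle>) = \<epsilon>(c1) \<langle>a, c2\<rangle> = \<langle>a,
  \<epsilon>(c1) c2\<rangle>; the left counit law then sums the arguments up to c. So the action
  determines the pairing.\<close>

lemma counit_act:
  assumes a: "a \<in> carrier A" and c: "c \<in> carrier C"
  shows "counit C (act c a) = \<kappa> a c"
proof -
  interpret e: abelian_group_hom C R "counit C" by (rule C.counit_group_hom)
  have bal: "balanced_map R C C C (\<lambda>(c1, c2). counit C c1 \<rightharpoonup>\<^bsub>C\<^esub> c2)"
    by (rule balanced_mapI)
      (simp_all add: C.lsmult_l_distr C.lsmult_r_distr C.lsmult_assoc C.counit_rsmult)
  note lift = CC.tensor_lift_hom[OF C.M.abelian_group_axioms bal]
    CC.tensor_lift_pure[OF C.M.abelian_group_axioms bal]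
  have "counit C (act c a) = \<kappa> a (tensor_lift C (\<lambda>(c1, c2). counit C c1 \<rightharpoonup>\<^bsub>C\<^esub> c2) (comult C c))"
    unfolding act_def
    by (rule CC.tensor_hom_eqI[OF abelian_group_hom_comp[OF pair_lift_hom C.counit_group_hom]
        abelian_group_hom_comp[OF lift(1) kappa_group_hom]])
      (use a c in \<open>simp_all add: pair_lift_pure lift(2) C.counit_rsmult kappa_lsmult\<close>)
  then show ?thesis using C.counit_left[OF c] by simp
qed

text \<open>Both sides are values of one additive map on the two sides of the coassociativity law.
  One bracketing recovers the product of the left dual, hence \<open>a \<otimes> b\<close>; in the
  other, right linearity of \<Delta> turns the scalar \<langle>a, z\<rangle> into the first action,
  which is followed by that of b.\<close>

lemma act_mult:
  assumes a: "a \<in> carrier A" and b: "b \<in> carrier A" and c: "c \<in> carrier C"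
  shows "act c (a \<otimes>\<^bsub>A\<^esub> b) = act (act c a) b"
proof -
  let ?T = "tensor R C C" and ?TR = "tensor R C (tensor R C C)"
  interpret ka: abelian_group_hom C R "\<kappa> a" by (rule kappa_group_hom[OF a])
  interpret kb: abelian_group_hom C R "\<kappa> b" by (rule kappa_group_hom[OF b])
  interpret D: abelian_group_hom C ?T "comult C" by (rule C.comult_group_hom)
  note [simp] = a b
  have Rg: "abelian_group R" by (rule C.counit_group_hom[THEN abelian_group_hom.axioms(2)])
  have Cg: "abelian_group C" by (rule C.M.abelian_group_axioms)
  \<comment> \<open>This is the functional y \<otimes> z \<mapsto> \<langle>b, y \<langle>a,
    z\<rangle>\<rangle>. By \<open>kappa_mult\<close> its value at \<Delta>(c) is \<langle>ab,
    c\<rangle>. Its left linearity, shown next, is what makes the map on triple tensors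
    balanced.\<close>
  let ?g = "tensor_lift R (\<lambda>(y, z). \<kappa> b (y \<leftharpoonup>\<^bsub>C\<^esub> \<kappa> a z))"
  have balg: "balanced_map R C C R (\<lambda>(y, z). \<kappa> b (y \<leftharpoonup>\<^bsub>C\<^esub> \<kappa> a z))"
    by (rule balanced_mapI) (simp_all add: C.rsmult_l_distr C.rsmult_r_distr C.rsmult_assoc kappa_lsmult)
  note g = CC.tensor_lift_hom[OF Rg balg] CC.tensor_lift_pure[OF Rg balg]
  interpret g: abelian_group_hom ?T R ?g by (rule g(1))
  have g_lin: "?g (r \<rightharpoonup>\<^bsub>?T\<^esub> X) = r \<otimes>\<^bsub>R\<^esub> ?g X" if r: "r \<in> carrier R" and X: "X \<in> carrier ?T" for r X
  proof -
    have rh: "abelian_group_hom R R (\<lambda>s. r \<otimes>\<^bsub>R\<^esub> s)"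
      by (rule abelian_group_homI') (use r Rg in \<open>simp_all add: R.r_distr\<close>)
    show ?thesis
      by (rule CC.tensor_hom_eqI[OF abelian_group_hom_comp[OF CC.lsmult_tensor(1) g(1)]
          abelian_group_hom_comp[OF g(1) rh]])
        (use r X in \<open>simp_all add: g(2) CC.lsmult_tensor(2) C.lsmult_rsmult_assoc kappa_lsmult\<close>)
  qed
  txt \<open>Coassociativity is evaluated under \<open>x \<otimes> y \<otimes> z \<mapsto> x \<langle>b, y \<langle>a, z\<rangle>\<rangle>\<close>.\<close>
  let ?\<Phi> = "tensor_lift C (\<lambda>(x, X). x \<leftharpoonup>\<^bsub>C\<^esub> ?g X)"
  have bal\<Phi>: "balanced_map R C ?T C (\<lambda>(x, X). x \<leftharpoonup>\<^bsub>C\<^esub> ?g X)"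
    by (rule balanced_mapI) (simp_all add: C.rsmult_l_distr C.rsmult_r_distr C.rsmult_assoc g_lin)
  note \<Phi> = Rt.tensor_lift_hom[OF Cg bal\<Phi>] Rt.tensor_lift_pure[OF Cg bal\<Phi>]

  \<comment> \<open>On x \<otimes> y the evaluation gives x times ?g(\<Delta>(y)), which is x
    \<langle>ab, y\<rangle>.\<close>
  have right: "?\<Phi> (tensor_map R C ?T id (comult C) X) = tensor_lift C (pair_map (a \<otimes>\<^bsub>A\<^esub> b)) X"
    if X: "X \<in> carrier ?T" for X
  proof -
    have bal: "balanced_map R C C ?TR (\<lambda>(x, y). pure_tensor R C ?T x (comult C y))"
      by (rule balanced_mapI)
        (simp_all add: Rt.pure_tensor_add_left Rt.pure_tensor_add_right Rt.pure_tensor_middle C.comult_lsmult)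
    note m = CC.tensor_lift_hom[OF Rt.abelian_group_tensor bal] CC.tensor_lift_pure[OF Rt.abelian_group_tensor bal]
    show ?thesis
      unfolding tensor_map_def id_apply
      by (rule CC.tensor_hom_eqI[OF abelian_group_hom_comp[OF m(1) \<Phi>(1)] pair_lift_hom])
        (use X in \<open>simp_all add: m(2) \<Phi>(2) pair_lift_pure kappa_mult\<close>)
  qed

  \<comment> \<open>For a fixed third factor z, this is the inner lift in
    \<open>tensor_assoc\<close>, sending x \<otimes> y to x \<otimes> (y \<otimes> z). Additivity in
    z and the exchange of scalars between X and z are the conditions under which the outer lift is
    balanced.\<close>
  let ?\<beta> = "\<lambda>z. tensor_lift ?TR (\<lambda>(x, y). pure_tensor R C ?T x (pure_tensor R C C y z))"
  have bal\<beta>: "balanced_map R C C ?TR (\<lambda>(x, y). pure_tensor R C ?T x (pure_tensor R C C y z))"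
    if "z \<in> carrier C" for z
    by (rule balanced_mapI)
      (use that in \<open>simp_all add: Rt.pure_tensor_add_left Rt.pure_tensor_add_right
        CC.pure_tensor_add_left Rt.pure_tensor_middle CC.lsmult_tensor(2)\<close>)
  note \<beta> = CC.tensor_lift_hom[OF Rt.abelian_group_tensor bal\<beta>]
    CC.tensor_lift_pure[OF Rt.abelian_group_tensor bal\<beta>]
  have \<beta>_add: "?\<beta> (z \<oplus>\<^bsub>C\<^esub> z') X = ?\<beta> z X \<oplus>\<^bsub>?TR\<^esub> ?\<beta> z' X"
    if "z \<in> carrier C" "z' \<in> carrier C" "X \<in> carrier ?T" for z z' X
    by (rule CC.tensor_hom_eqI[OF \<beta>(1) abelian_group_hom_add[OF \<beta>(1) \<beta>(1)]])
      (use that in \<open>simp_all add: \<beta>(2) CC.pure_tensor_add_right Rt.pure_tensor_add_right\<close>)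
  have \<beta>_middle: "?\<beta> z (X \<leftharpoonup>\<^bsub>?T\<^esub> r) = ?\<beta> (r \<rightharpoonup>\<^bsub>C\<^esub> z) X"
    if "z \<in> carrier C" "r \<in> carrier R" "X \<in> carrier ?T" for z r X
    by (rule CC.tensor_hom_eqI[OF abelian_group_hom_comp[OF CC.rsmult_tensor(1) \<beta>(1)] \<beta>(1)])
      (use that in \<open>simp_all add: \<beta>(2) CC.rsmult_tensor(2) CC.pure_tensor_middle\<close>)
  have balas: "balanced_map R ?T C ?TR (\<lambda>(X, z). ?\<beta> z X)"
    by (rule balanced_mapI)
      (simp_all add: \<beta>_add \<beta>_middle abelian_group_hom.hom_closed[OF \<beta>(1)] abelian_group_hom.hom_add[OF \<beta>(1)])
  note as = L.tensor_lift_hom[OF Rt.abelian_group_tensor balas] L.tensor_lift_pure[OF Rt.abelian_group_tensor balas]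
  \<comment> \<open>In x \<langle>b, y \<langle>a, z\<rangle>\<rangle> the scalar \<langle>a,
    z\<rangle> acts on the second factor of x \<otimes> y, that is, from the right on the whole
    tensor. For X = \<Delta>(x) it can therefore be moved inside \<Delta>.\<close>
  have \<Phi>\<beta>: "?\<Phi> (?\<beta> z X) = tensor_lift C (pair_map b) (X \<leftharpoonup>\<^bsub>?T\<^esub> \<kappa> a z)"
    if "z \<in> carrier C" "X \<in> carrier ?T" for z X
    by (rule CC.tensor_hom_eqI[OF abelian_group_hom_comp[OF \<beta>(1) \<Phi>(1)]
        abelian_group_hom_comp[OF CC.rsmult_tensor(1) pair_lift_hom]])
      (use that in \<open>simp_all add: \<beta>(2) \<Phi>(2) g(2) CC.rsmult_tensor(2) pair_lift_pure\<close>)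
  have left: "?\<Phi> (tensor_assoc R C C C (tensor_map R ?T C (comult C) id X)) =
      tensor_lift C (pair_map b) (comult C (tensor_lift C (pair_map a) X))"
    if X: "X \<in> carrier ?T" for X
  proof -
    have bal: "balanced_map R C C (tensor R ?T C) (\<lambda>(x, y). pure_tensor R ?T C (comult C x) y)"
      by (rule balanced_mapI)
        (simp_all add: L.pure_tensor_add_left L.pure_tensor_add_right L.pure_tensor_middle C.comult_rsmult)
    note m = CC.tensor_lift_hom[OF L.abelian_group_tensor bal] CC.tensor_lift_pure[OF L.abelian_group_tensor bal]
    show ?thesis
      unfolding tensor_map_def tensor_assoc_def id_apply
      by (rule CC.tensor_hom_eqI[OF
          abelian_group_hom_comp[OF abelian_group_hom_comp[OF m(1) as(1)] \<Phi>(1)]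
          abelian_group_hom_comp[OF abelian_group_hom_comp[OF pair_lift_hom C.comult_group_hom] pair_lift_hom]])
        (use X in \<open>simp_all add: m(2) as(2) \<Phi>\<beta> pair_lift_pure C.comult_rsmult\<close>)
  qed
  show ?thesis
    unfolding act_def
    using left[of "comult C c"] right[of "comult C c"] C.coassoc[OF c] c by simp
qed

lemma right_module_pairing: "right_module A (pairing_module C \<kappa>)"
proof -
  have carrier: "carrier (pairing_module C \<kappa>) = carrier C"
    and add: "add (pairing_module C \<kappa>) = add C"
    and zero: "\<zero>\<^bsub>pairing_module C \<kappa>\<^esub> = \<zero>\<^bsub>C\<^esub>"
    by (simp_all add: pairing_module_def)
  have "abelian_group (pairing_module C \<kappa>)"
    by (rule abelian_group_from_comm_group[OF C.M.a_comm_group]) (simp_all add: carrier add zero)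
  then show ?thesis
    using abelian_group_hom.hom_closed[OF act_group_hom] abelian_group_hom.hom_add[OF act_group_hom]
    by (intro right_module.intro right_module_axioms.intro A.A.ring_axioms)
      (simp_all only: carrier add act_add act_mult act_one)
qed

text \<open>F collects second tensor factors of \<Delta>(c) and must not depend on a. The proof
  replaces \<Delta>(c) by an arbitrary tensor X, so that induction can build F: {y} for a pure
  tensor x \<otimes> y, and unions for differences.\<close>

lemma act_eq_zero_if_annihilated:
  assumes c: "c \<in> carrier C"
  shows "\<exists>F. finite F \<and> F \<subseteq> carrier C \<and>
    (\<forall>a\<in>carrier A. (\<forall>d\<in>F. \<kappa> a d = \<zero>\<^bsub>R\<^esub>) \<longrightarrow> act c a = \<zero>\<^bsub>C\<^esub>)"
proof -
  have "\<exists>F. finite F \<and> F \<subseteq> carrier C \<and>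
      (\<forall>a\<in>carrier A. (\<forall>d\<in>F. \<kappa> a d = \<zero>\<^bsub>R\<^esub>) \<longrightarrow> tensor_lift C (pair_map a) X = \<zero>\<^bsub>C\<^esub>)"
    if "X \<in> carrier (tensor R C C)" for X
    using that
  proof (induction X rule: CC.tensor_induct)
    case zero
    then show ?case
      using abelian_group_hom.hom_zero[OF pair_lift_hom] by (intro exI[of _ "{}"]) simp
  next
    case (pure x y)
    then show ?case by (intro exI[of _ "{y}"]) (simp add: pair_lift_pure)
  next
    case (diff X Y)
    then obtain F G where F: "finite F \<and> F \<subseteq> carrier C \<and>
        (\<forall>a\<in>carrier A. (\<forall>d\<in>F. \<kappa> a d = \<zero>\<^bsub>R\<^esub>) \<longrightarrow> tensor_lift C (pair_map a) X = \<zero>\<^bsub>C\<^esub>)"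
      and G: "finite G \<and> G \<subseteq> carrier C \<and>
        (\<forall>a\<in>carrier A. (\<forall>d\<in>G. \<kappa> a d = \<zero>\<^bsub>R\<^esub>) \<longrightarrow> tensor_lift C (pair_map a) Y = \<zero>\<^bsub>C\<^esub>)"
      by blast
    have "tensor_lift C (pair_map a) (X \<ominus>\<^bsub>tensor R C C\<^esub> Y)
        = tensor_lift C (pair_map a) X \<ominus>\<^bsub>C\<^esub> tensor_lift C (pair_map a) Y" if "a \<in> carrier A" for a
    proof -
      interpret h: abelian_group_hom "tensor R C C" C "tensor_lift C (pair_map a)"
        by (rule pair_lift_hom[OF that])
      show ?thesis using diff by (simp add: CC.T.minus_eq C.M.minus_eq)
    qed
    with F G show ?case
      by (intro exI[of _ "F \<union> G"]) (auto simp: C.M.minus_eq)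
  qed
  from this[OF C.comult_closed[OF c]] show ?thesis
    unfolding act_def .
qed

end


section \<open>Linear topologies\<close>

lemma mem_a_l_coset: "y \<in> x <+\<^bsub>A\<^esub> V \<longleftrightarrow> (\<exists>v\<in>V. y = x \<oplus>\<^bsub>A\<^esub> v)"
  by (auto simp: a_l_coset_def')

text \<open>Openness at x only asks for some basic coset inside the set, and a coset of V contains
  the corresponding coset of any smaller basic set.\<close>

lemma linear_topology_cong:
  assumes "\<And>V. V \<in> \<B> \<Longrightarrow> \<exists>W\<in>\<B>'. W \<subseteq> V" "\<And>W. W \<in> \<B>' \<Longrightarrow> \<exists>V\<in>\<B>. V \<subseteq> W"
  shows "linear_topology A \<B> = linear_topology A \<B>'"
proof -
  have mono: "x <+\<^bsub>A\<^esub> V \<subseteq> x <+\<^bsub>A\<^esub> W" if "V \<subseteq> W" for x V W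
    using that unfolding a_l_coset_def' by blast
  have "(\<exists>V\<in>\<B>. x <+\<^bsub>A\<^esub> V \<subseteq> U) \<longleftrightarrow> (\<exists>V\<in>\<B>'. x <+\<^bsub>A\<^esub> V \<subseteq> U)" for x U
    using assms mono by (meson subset_trans)
  then show ?thesis by (simp add: linear_topology_def)
qed

text \<open>Conditions for a family of right ideals to be a base at 0 of a ring topology.
  \<open>base_mult\<close> is the continuity at 0 of left multiplication by a; for right
  multiplications it is built into the notion of right ideal.\<close>

locale right_ideal_base = ring A for A :: "('a, 'y) ring_scheme" (structure) +
  fixes \<B> :: "'a set set"
  assumes base_nonempty: "\<B> \<noteq> {}"
    and base_right_ideal: "V \<in> \<B> \<Longrightarrow> right_ideal V A"
    and base_directed: "\<lbrakk>V \<in> \<B>; W \<in> \<B>\<rbrakk> \<Longrightarrow> \<exists>U\<in>\<B>. U \<subseteq> V \<inter> W"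
    and base_mult: "\<lbrakk>a \<in> carrier A; W \<in> \<B>\<rbrakk> \<Longrightarrow> \<exists>V\<in>\<B>. \<forall>v\<in>V. a \<otimes> v \<in> W"
begin

abbreviation "\<T> \<equiv> linear_topology A \<B>"

lemma openin_iff: "openin \<T> U \<longleftrightarrow> U \<subseteq> carrier A \<and> (\<forall>x\<in>U. \<exists>V\<in>\<B>. x <+ V \<subseteq> U)"
  using base_directed by (rule openin_linear_topology)

lemma base_subgroup: "V \<in> \<B> \<Longrightarrow> additive_subgroup V A"
  using base_right_ideal by (simp add: right_ideal_def)

lemma base_subset: "V \<in> \<B> \<Longrightarrow> V \<subseteq> carrier A"
  using additive_subgroup.a_subset[OF base_subgroup] .

lemma self_mem_coset: "\<lbrakk>x \<in> carrier A; V \<in> \<B>\<rbrakk> \<Longrightarrow> x \<in> x <+ V"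
  using additive_subgroup.zero_closed[OF base_subgroup] by (force simp: mem_a_l_coset)

lemma openin_coset:
  assumes "x \<in> carrier A" "V \<in> \<B>"
  shows "openin \<T> (x <+ V)"
  unfolding openin_iff
proof (intro conjI ballI)
  show "x <+ V \<subseteq> carrier A"
    using assms base_subset[OF assms(2)] by (auto simp: mem_a_l_coset subset_iff)
  fix y assume "y \<in> x <+ V"
  then obtain v where v: "v \<in> V" "y = x \<oplus> v" by (auto simp: mem_a_l_coset)
  have "y \<oplus> w \<in> x <+ V" if "w \<in> V" for w
  proof -
    have "y \<oplus> w = x \<oplus> (v \<oplus> w)" "v \<oplus> w \<in> V"
      using v that assms base_subset[OF assms(2)] additive_subgroup.a_closed[OF base_subgroup[OF assms(2)]]
      by (auto simp: subset_iff a_assoc)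
    then show ?thesis by (auto simp: mem_a_l_coset)
  qed
  then have "y <+ V \<subseteq> x <+ V" by (force simp: mem_a_l_coset)
  then show "\<exists>W\<in>\<B>. y <+ W \<subseteq> x <+ V" using assms(2) by blast
qed

lemma openin_base: "V \<in> \<B> \<Longrightarrow> openin \<T> V"
proof -
  assume V: "V \<in> \<B>"
  have "\<zero> <+ V = V" using base_subset[OF V] by (auto simp: mem_a_l_coset subset_iff)
  then show ?thesis using openin_coset[OF zero_closed V] by simp
qed

lemma topspace_eq: "topspace \<T> = carrier A"
proof
  show "topspace \<T> \<subseteq> carrier A" by (auto simp: topspace_def openin_iff)
  obtain V where V: "V \<in> \<B>" using base_nonempty by blast
  then have "openin \<T> (carrier A)"
    unfolding openin_iff using base_subset[OF V] by (auto simp: mem_a_l_coset subset_iff intro!: bexI[OF _ V])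
  then show "carrier A \<subseteq> topspace \<T>" by (auto simp: topspace_def)
qed

text \<open>Used for both ring operations. One V serves for both arguments, as directedness of the
  base permits.\<close>

lemma continuous_map_prodI:
  assumes closed: "\<And>a b. \<lbrakk>a \<in> carrier A; b \<in> carrier A\<rbrakk> \<Longrightarrow> h a b \<in> carrier A"
    and cont: "\<And>a b W. \<lbrakk>a \<in> carrier A; b \<in> carrier A; W \<in> \<B>\<rbrakk>
      \<Longrightarrow> \<exists>V\<in>\<B>. \<forall>v\<in>V. \<forall>w\<in>V. h (a \<oplus> v) (b \<oplus> w) \<in> h a b <+ W"
  shows "continuous_map (prod_topology \<T> \<T>) \<T> (\<lambda>(a, b). h a b)"
  unfolding continuous_map_def
proof (intro conjI allI impI)
  show "(\<lambda>(a, b). h a b) \<in> topspace (prod_topology \<T> \<T>) \<rightarrow> topspace \<T>"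
    using closed by (auto simp: topspace_eq)
  fix U assume U: "openin \<T> U"
  let ?P = "{p \<in> topspace (prod_topology \<T> \<T>). (case p of (a, b) \<Rightarrow> h a b) \<in> U}"
  have "\<exists>V W. openin \<T> V \<and> openin \<T> W \<and> a \<in> V \<and> b \<in> W \<and> V \<times> W \<subseteq> ?P" if "(a, b) \<in> ?P" for a b
  proof -
    from that have ab: "a \<in> carrier A" "b \<in> carrier A" "h a b \<in> U" by (auto simp: topspace_eq)
    then obtain W where W: "W \<in> \<B>" "h a b <+ W \<subseteq> U" using U unfolding openin_iff by blast
    obtain V where V: "V \<in> \<B>" "\<forall>v\<in>V. \<forall>w\<in>V. h (a \<oplus> v) (b \<oplus> w) \<in> h a b <+ W"
      using cont[OF ab(1,2) W(1)] by blast
    have "(a <+ V) \<times> (b <+ V) \<subseteq> ?P"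
    proof (clarsimp simp: mem_a_l_coset topspace_eq)
      fix v w assume vw: "v \<in> V" "w \<in> V"
      then have "v \<in> carrier A" "w \<in> carrier A" using base_subset[OF V(1)] by auto
      moreover have "h (a \<oplus> v) (b \<oplus> w) \<in> U" using V(2) W(2) vw by blast
      ultimately show "a \<oplus> v \<in> carrier A \<and> b \<oplus> w \<in> carrier A \<and> h (a \<oplus> v) (b \<oplus> w) \<in> U"
        using ab(1,2) by simp
    qed
    then show ?thesis
      using openin_coset[OF ab(1) V(1)] openin_coset[OF ab(2) V(1)]
        self_mem_coset[OF ab(1) V(1)] self_mem_coset[OF ab(2) V(1)]
      by (intro exI[of _ "a <+ V"] exI[of _ "b <+ V"] conjI)
  qed
  then show "openin (prod_topology \<T> \<T>) ?P"
    unfolding openin_prod_topology_alt by blast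
qed

lemma topological_ring: "topological_ring A \<T>"
  unfolding topological_ring_def
proof (intro conjI)
  show "continuous_map (prod_topology \<T> \<T>) \<T> (\<lambda>(a, b). a \<oplus> b)"
  proof (rule continuous_map_prodI)
    fix a b W assume *: "a \<in> carrier A" "b \<in> carrier A" "W \<in> \<B>"
    have "a \<oplus> v \<oplus> (b \<oplus> w) \<in> a \<oplus> b <+ W" if "v \<in> W" "w \<in> W" for v w
    proof -
      have "v \<in> carrier A" "w \<in> carrier A" using that base_subset[OF *(3)] by auto
      then have "a \<oplus> v \<oplus> (b \<oplus> w) = a \<oplus> b \<oplus> (v \<oplus> w)" using * by (simp add: a_ac)
      moreover have "v \<oplus> w \<in> W" using additive_subgroup.a_closed[OF base_subgroup[OF *(3)] that] .
      ultimately show ?thesis by (auto simp: mem_a_l_coset)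
    qed
    then show "\<exists>V\<in>\<B>. \<forall>v\<in>V. \<forall>w\<in>V. a \<oplus> v \<oplus> (b \<oplus> w) \<in> a \<oplus> b <+ W" using *(3) by blast
  qed simp
  show "continuous_map (prod_topology \<T> \<T>) \<T> (\<lambda>(a, b). a \<otimes> b)"
  proof (rule continuous_map_prodI)
    fix a b W assume *: "a \<in> carrier A" "b \<in> carrier A" "W \<in> \<B>"
    \<comment> \<open>(a + v)(b + w) differs from ab by a w + v (b + w). The choice of V' puts a w
      into W, and v (b + w) lies in W because W is a right ideal; hence V is taken inside both V'
      and W.\<close>
    obtain V' where V': "V' \<in> \<B>" "\<forall>v\<in>V'. a \<otimes> v \<in> W" using base_mult[OF *(1,3)] by blast
    obtain V where V: "V \<in> \<B>" "V \<subseteq> V' \<inter> W" using base_directed[OF V'(1) *(3)] by blast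
    have "(a \<oplus> v) \<otimes> (b \<oplus> w) \<in> a \<otimes> b <+ W" if "v \<in> V" "w \<in> V" for v w
    proof -
      have vw: "v \<in> carrier A" "w \<in> carrier A" using that base_subset[OF V(1)] by auto
      then have "(a \<oplus> v) \<otimes> (b \<oplus> w) = a \<otimes> b \<oplus> (a \<otimes> w \<oplus> v \<otimes> (b \<oplus> w))"
        using * by (simp add: l_distr r_distr a_ac)
      moreover have "a \<otimes> w \<in> W" using that V V' by blast
      moreover have "v \<otimes> (b \<oplus> w) \<in> W"
        using base_right_ideal[OF *(3)] that V vw *(2) by (auto simp: right_ideal_def)
      ultimately show ?thesis
        using additive_subgroup.a_closed[OF base_subgroup[OF *(3)]] by (auto simp: mem_a_l_coset)
    qed
    then show "\<exists>V\<in>\<B>. \<forall>v\<in>V. \<forall>w\<in>V. (a \<oplus> v) \<otimes> (b \<oplus> w) \<in> a \<otimes> b <+ W" using V(1) by blast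
  qed simp
  show "continuous_map \<T> \<T> (\<lambda>a. \<ominus> a)"
    unfolding continuous_map_def
  proof (intro conjI allI impI)
    show "(\<lambda>a. \<ominus> a) \<in> topspace \<T> \<rightarrow> topspace \<T>" by (auto simp: topspace_eq)
    fix U assume U: "openin \<T> U"
    have "\<exists>V\<in>\<B>. x <+ V \<subseteq> {a \<in> carrier A. \<ominus> a \<in> U}" if x: "x \<in> carrier A" "\<ominus> x \<in> U" for x
    proof -
      obtain V where V: "V \<in> \<B>" "(\<ominus> x) <+ V \<subseteq> U" using U x unfolding openin_iff by blast
      have "\<ominus> (x \<oplus> v) \<in> U" if "v \<in> V" for v
      proof -
        have "v \<in> carrier A" using that base_subset[OF V(1)] by auto
        then have "\<ominus> (x \<oplus> v) = \<ominus> x \<oplus> \<ominus> v" using x by (simp add: minus_add)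
        moreover have "\<ominus> v \<in> V"
          using additive_subgroup.a_inv_closed[OF base_subgroup[OF V(1)]] that is_abelian_group by blast
        ultimately have "\<ominus> (x \<oplus> v) \<in> (\<ominus> x) <+ V" by (auto simp: mem_a_l_coset)
        then show ?thesis using V(2) by blast
      qed
      moreover have "x \<oplus> v \<in> carrier A" if "v \<in> V" for v
        using that base_subset[OF V(1)] x(1) by blast
      ultimately have "x <+ V \<subseteq> {a \<in> carrier A. \<ominus> a \<in> U}"
        unfolding a_l_coset_def' by blast
      then show ?thesis using V(1) by blast
    qed
    then show "openin \<T> {a \<in> topspace \<T>. \<ominus> a \<in> U}"
      by (auto simp: openin_iff topspace_eq)
  qed
qed (simp_all add: ring_axioms topspace_eq)

lemma nbhd_base_at_zero: "nbhd_base_at \<T> \<zero> \<B>"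
  unfolding nbhd_base_at_def
proof (intro conjI ballI allI impI)
  show "\<exists>U. openin \<T> U \<and> \<zero> \<in> U \<and> U \<subseteq> V" if "V \<in> \<B>" for V
    using openin_base[OF that] additive_subgroup.zero_closed[OF base_subgroup[OF that]] by blast
  fix U assume "openin \<T> U \<and> \<zero> \<in> U"
  then obtain V where V: "V \<in> \<B>" "\<zero> <+ V \<subseteq> U" unfolding openin_iff by blast
  then have "V \<subseteq> U" using base_subset[OF V(1)] by (force simp: mem_a_l_coset)
  then show "\<exists>V\<in>\<B>. V \<subseteq> U" using V(1) by blast
qed

text \<open>A subgroup containing a basic V contains x + V for each of its elements x. Applied to
  annihilators of elements, this removes the topology from the notion of discreteness.\<close>

lemma openin_additive_subgroup_iff:
  assumes "additive_subgroup H A"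
  shows "openin \<T> H \<longleftrightarrow> (\<exists>V\<in>\<B>. V \<subseteq> H)"
proof
  show "\<exists>V\<in>\<B>. V \<subseteq> H" if "openin \<T> H"
    using nbhd_base_at_zero that additive_subgroup.zero_closed[OF assms]
    by (auto simp: nbhd_base_at_def)
  assume "\<exists>V\<in>\<B>. V \<subseteq> H"
  then obtain V where V: "V \<in> \<B>" "V \<subseteq> H" by blast
  have "x <+ V \<subseteq> H" if "x \<in> H" for x
    using V(2) that additive_subgroup.a_closed[OF assms that] unfolding a_l_coset_def' by blast
  then show "openin \<T> H"
    unfolding openin_iff using V(1) additive_subgroup.a_subset[OF assms] by blast
qed

end

section \<open>Annihilators of finite sets as a base of right ideals\<close>

context right_module
begin

lemma annihilator_subgroup:
  assumes "F \<subseteq> carrier M"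
  shows "additive_subgroup (annihilator R M F) R"
proof (rule additive_subgroupI, rule R.add.subgroupI)
  have F: "m \<in> carrier M" if "m \<in> F" for m using that assms by blast
  show "annihilator R M F \<subseteq> carrier R" by (auto simp: annihilator_def)
  have "\<zero>\<^bsub>R\<^esub> \<in> annihilator R M F" using F by (simp add: annihilator_def)
  then show "annihilator R M F \<noteq> {}" by blast
  show "\<ominus>\<^bsub>R\<^esub> a \<in> annihilator R M F" if "a \<in> annihilator R M F" for a
    using that F by (simp add: annihilator_def rsmult_minus_right)
  show "a \<oplus>\<^bsub>R\<^esub> b \<in> annihilator R M F" if "a \<in> annihilator R M F" "b \<in> annihilator R M F" for a b
    using that F by (simp add: annihilator_def rsmult_r_distr)
qed

lemma right_ideal_annihilator: "F \<subseteq> carrier M \<Longrightarrow> right_ideal (annihilator R M F) R"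
  unfolding right_ideal_def
  using annihilator_subgroup by (auto simp: annihilator_def rsmult_assoc subset_iff)

lemma right_ideal_base_annihilator:
  "right_ideal_base R {annihilator R M F | F. finite F \<and> F \<subseteq> carrier M}"
proof (unfold_locales, goal_cases)
  case 1
  then show ?case by blast
next
  case (2 V)
  then show ?case using right_ideal_annihilator by blast
next
  case (3 V W)
  then obtain F G where "finite F" "F \<subseteq> carrier M" "V = annihilator R M F"
    "finite G" "G \<subseteq> carrier M" "W = annihilator R M G" by blast
  then show ?case
    by (intro bexI[of _ "annihilator R M (F \<union> G)"]) (auto simp: annihilator_def)
next
  case (4 a W)
  then obtain F where F: "finite F" "F \<subseteq> carrier M" "W = annihilator R M F" by blast
  let ?G = "(\<lambda>m. m \<leftharpoonup>\<^bsub>M\<^esub> a) ` F"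
  have "finite ?G" "?G \<subseteq> carrier M" using F 4(1) by auto
  moreover have "\<forall>v\<in>annihilator R M ?G. a \<otimes>\<^bsub>R\<^esub> v \<in> W"
    using F 4(1) by (auto simp: annihilator_def rsmult_assoc subset_iff)
  ultimately show ?case by blast
qed

end

section \<open>Subgenerated modules\<close>

definition rmod_hom ::
    "('a, 'x) ring_scheme \<Rightarrow> ('a, 'm, 'y) rmod_scheme \<Rightarrow> ('a, 'n, 'z) rmod_scheme \<Rightarrow> ('m \<Rightarrow> 'n) set"
  where "rmod_hom A M N = {h \<in> carrier M \<rightarrow> carrier N.
    (\<forall>x\<in>carrier M. \<forall>y\<in>carrier M. h (x \<oplus>\<^bsub>M\<^esub> y) = h x \<oplus>\<^bsub>N\<^esub> h y) \<and>
    (\<forall>x\<in>carrier M. \<forall>a\<in>carrier A. h (x \<leftharpoonup>\<^bsub>M\<^esub> a) = h x \<leftharpoonup>\<^bsub>N\<^esub> a)}"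

lemma rmod_hom_abelian_group_hom:
  assumes "right_module A M" "right_module A N" "h \<in> rmod_hom A M N"
  shows "abelian_group_hom M N h"
proof -
  interpret M: right_module A M by fact
  interpret N: right_module A N by fact
  show ?thesis
    by (rule abelian_group_homI'[OF M.M.abelian_group_axioms N.abelian_group_axioms])
      (use assms(3) in \<open>auto simp: rmod_hom_def\<close>)
qed

text \<open>A as a right module over itself: its direct sums of copies are the free modules.\<close>

lemma right_module_regular:
  assumes "ring A" shows "right_module A (regular_bimod A)"
proof -
  interpret ring A by fact
  have "abelian_group (regular_bimod A)"
    by (rule abelian_group_from_comm_group[OF a_comm_group]) (simp_all add: regular_bimod_def)
  then show ?thesis
    by (intro right_module.intro right_module_axioms.intro ring_axioms)
      (simp_all add: regular_bimod_def l_distr r_distr m_assoc)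
qed

lemma right_module_direct_sum_copies:
  assumes "right_module A M"
  shows "right_module A (direct_sum_copies I M)"
proof -
  interpret right_module A M by fact
  let ?D = "direct_sum_copies I M"
  have carrier: "f \<in> carrier ?D \<longleftrightarrow> f \<in> I \<rightarrow>\<^sub>E carrier M \<and> finite {i \<in> I. f i \<noteq> \<zero>\<^bsub>M\<^esub>}" for f
    by (simp add: direct_sum_copies_def)
  have mem: "f i \<in> carrier M" if "f \<in> carrier ?D" "i \<in> I" for f i
    using that by (auto simp: carrier)
  have add: "f \<oplus>\<^bsub>?D\<^esub> g = (\<lambda>i\<in>I. f i \<oplus>\<^bsub>M\<^esub> g i)" and zero: "\<zero>\<^bsub>?D\<^esub> = (\<lambda>i\<in>I. \<zero>\<^bsub>M\<^esub>)"
    and act: "f \<leftharpoonup>\<^bsub>?D\<^esub> a = (\<lambda>i\<in>I. f i \<leftharpoonup>\<^bsub>M\<^esub> a)" for f g a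
    by (simp_all add: direct_sum_copies_def)
  \<comment> \<open>Elements of the direct sum are extensional on I, so the module axioms can be
    checked componentwise.\<close>
  have eqI: "f = g" if "f \<in> carrier ?D" "g \<in> carrier ?D" "\<And>i. i \<in> I \<Longrightarrow> f i = g i" for f g
    using that by (auto simp: carrier intro: PiE_ext)
  have add_closed: "f \<oplus>\<^bsub>?D\<^esub> g \<in> carrier ?D" if "f \<in> carrier ?D" "g \<in> carrier ?D" for f g
  proof -
    have "{i \<in> I. f i \<oplus>\<^bsub>M\<^esub> g i \<noteq> \<zero>\<^bsub>M\<^esub>} \<subseteq> {i \<in> I. f i \<noteq> \<zero>\<^bsub>M\<^esub>} \<union> {i \<in> I. g i \<noteq> \<zero>\<^bsub>M\<^esub>}" by auto
    then have "finite {i \<in> I. f i \<oplus>\<^bsub>M\<^esub> g i \<noteq> \<zero>\<^bsub>M\<^esub>}"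
      using that by (rule_tac finite_subset) (auto simp: carrier)
    then show ?thesis using that by (auto simp: carrier add mem cong: conj_cong)
  qed
  have act_closed: "f \<leftharpoonup>\<^bsub>?D\<^esub> a \<in> carrier ?D" if "f \<in> carrier ?D" "a \<in> carrier A" for f a
  proof -
    have "{i \<in> I. f i \<leftharpoonup>\<^bsub>M\<^esub> a \<noteq> \<zero>\<^bsub>M\<^esub>} \<subseteq> {i \<in> I. f i \<noteq> \<zero>\<^bsub>M\<^esub>}" using that by auto
    then have "finite {i \<in> I. f i \<leftharpoonup>\<^bsub>M\<^esub> a \<noteq> \<zero>\<^bsub>M\<^esub>}"
      using that by (rule_tac finite_subset) (auto simp: carrier)
    then show ?thesis using that by (auto simp: carrier act mem cong: conj_cong)
  qed
  have zero_closed: "\<zero>\<^bsub>?D\<^esub> \<in> carrier ?D" by (auto simp: carrier zero cong: conj_cong)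
  have "abelian_group ?D"
  proof (rule abelian_groupI)
    fix f assume f: "f \<in> carrier ?D"
    show "\<zero>\<^bsub>?D\<^esub> \<oplus>\<^bsub>?D\<^esub> f = f"
      by (rule eqI[OF add_closed[OF zero_closed f] f]) (simp add: add zero mem[OF f])
    have "{i \<in> I. \<ominus>\<^bsub>M\<^esub> f i \<noteq> \<zero>\<^bsub>M\<^esub>} \<subseteq> {i \<in> I. f i \<noteq> \<zero>\<^bsub>M\<^esub>}" by auto
    then have "finite {i \<in> I. \<ominus>\<^bsub>M\<^esub> f i \<noteq> \<zero>\<^bsub>M\<^esub>}"
      using f by (rule_tac finite_subset) (auto simp: carrier)
    then have n: "(\<lambda>i\<in>I. \<ominus>\<^bsub>M\<^esub> f i) \<in> carrier ?D"
      using f by (auto simp: carrier mem cong: conj_cong)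
    have "(\<lambda>i\<in>I. \<ominus>\<^bsub>M\<^esub> f i) \<oplus>\<^bsub>?D\<^esub> f = \<zero>\<^bsub>?D\<^esub>"
      by (rule eqI[OF add_closed[OF n f] zero_closed]) (simp add: add zero mem[OF f] M.l_neg)
    then show "\<exists>g\<in>carrier ?D. g \<oplus>\<^bsub>?D\<^esub> f = \<zero>\<^bsub>?D\<^esub>" using n by blast
  next
    fix f g h assume fgh: "f \<in> carrier ?D" "g \<in> carrier ?D" "h \<in> carrier ?D"
    show "f \<oplus>\<^bsub>?D\<^esub> g \<oplus>\<^bsub>?D\<^esub> h = f \<oplus>\<^bsub>?D\<^esub> (g \<oplus>\<^bsub>?D\<^esub> h)"
      by (rule eqI) (use fgh in \<open>simp_all add: add_closed\<close>, simp add: add mem M.a_assoc)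
  next
    fix f g assume fg: "f \<in> carrier ?D" "g \<in> carrier ?D"
    show "f \<oplus>\<^bsub>?D\<^esub> g = g \<oplus>\<^bsub>?D\<^esub> f"
      by (rule eqI) (use fg in \<open>simp_all add: add_closed\<close>, simp add: add mem M.a_comm)
  qed (use add_closed zero_closed in auto)
  then show ?thesis
  proof (intro right_module.intro right_module_axioms.intro R.ring_axioms, goal_cases)
    case (2 f a)
    then show ?case by (simp add: act_closed)
  next
    case (3 f g a)
    then show ?case
      by (intro eqI) (simp_all add: add_closed act_closed, simp add: add act mem rsmult_l_distr)
  next
    case (4 f a b)
    then show ?case
      by (intro eqI) (simp_all add: add_closed act_closed, simp add: add act mem rsmult_r_distr)
  next
    case (5 f a b)
    then show ?case
      by (intro eqI) (simp_all add: act_closed, simp add: act mem rsmult_assoc)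
  next
    case (6 f)
    then show ?case
      by (intro eqI) (simp_all add: act_closed, simp add: act mem)
  qed
qed

text \<open>As for tensors, the action on a quotient is a union over representatives. Two
  representatives differ by some k in K, and k a stays in K, so all sets in the union
  coincide.\<close>

lemma rsmult_quotient_coset:
  assumes "right_module A M" "rsubmodule A K M" "x \<in> carrier M" "a \<in> carrier A"
  shows "(K +>\<^bsub>M\<^esub> x) \<leftharpoonup>\<^bsub>quotient_rmod M K\<^esub> a = K +>\<^bsub>M\<^esub> (x \<leftharpoonup>\<^bsub>M\<^esub> a)"
proof -
  interpret right_module A M by fact
  interpret K: abelian_subgroup K M
    using assms(2) M.abelian_group_axioms by (intro abelian_subgroupI3) (auto simp: rsubmodule_def)
  have "K +>\<^bsub>M\<^esub> (y \<leftharpoonup>\<^bsub>M\<^esub> a) = K +>\<^bsub>M\<^esub> (x \<leftharpoonup>\<^bsub>M\<^esub> a)" if y: "y \<in> K +>\<^bsub>M\<^esub> x" for y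
  proof -
    obtain k where k: "k \<in> K" "y = k \<oplus>\<^bsub>M\<^esub> x" using y by (auto simp: a_r_coset_def')
    have "k \<leftharpoonup>\<^bsub>M\<^esub> a \<in> K" using k assms(2,4) by (auto simp: rsubmodule_def)
    moreover have "y \<leftharpoonup>\<^bsub>M\<^esub> a = k \<leftharpoonup>\<^bsub>M\<^esub> a \<oplus>\<^bsub>M\<^esub> x \<leftharpoonup>\<^bsub>M\<^esub> a"
      using k assms(3,4) by (simp add: rsmult_l_distr)
    ultimately have "y \<leftharpoonup>\<^bsub>M\<^esub> a \<in> K +>\<^bsub>M\<^esub> (x \<leftharpoonup>\<^bsub>M\<^esub> a)" by (auto simp: a_r_coset_def')
    moreover have "x \<leftharpoonup>\<^bsub>M\<^esub> a \<in> carrier M" using assms(3,4) by simp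
    ultimately show ?thesis
      using M.a_repr_independence[OF _ _ K.a_subgroup] by metis
  qed
  then have "(\<Union>y\<in>K +>\<^bsub>M\<^esub> x. K +>\<^bsub>M\<^esub> (y \<leftharpoonup>\<^bsub>M\<^esub> a)) = K +>\<^bsub>M\<^esub> (x \<leftharpoonup>\<^bsub>M\<^esub> a)"
    using K.a_rcos_self[OF assms(3)] by (intro UN_constant_eq ballI)
  then show ?thesis by (simp add: quotient_rmod_def)
qed

text \<open>If \<open>M\<close> is the image of \<open>\<sigma> : P \<rightarrow> M\<close> and \<open>f : P \<rightarrow> D\<close> satisfies \<open>ker f \<subseteq> ker \<sigma>\<close>, then
  \<open>M \<cong> f P / f (ker \<sigma>)\<close>.\<close>

lemma rmod_iso_subquotient:
  assumes P: "right_module A P" and D: "right_module A D" and M: "right_module A M"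
    and f: "f \<in> rmod_hom A P D" and \<sigma>: "\<sigma> \<in> rmod_hom A P M"
    and surj: "\<And>m. m \<in> carrier M \<Longrightarrow> \<exists>p\<in>carrier P. \<sigma> p = m"
    and ker: "\<And>p. \<lbrakk>p \<in> carrier P; f p = \<zero>\<^bsub>D\<^esub>\<rbrakk> \<Longrightarrow> \<sigma> p = \<zero>\<^bsub>M\<^esub>"
  shows "\<exists>K N. rsubmodule A K D \<and> rsubmodule A N (quotient_rmod D K) \<and>
    rmod_iso A M ((quotient_rmod D K)\<lparr>carrier := N\<rparr>) \<noteq> {}"
proof -
  interpret P: right_module A P by fact
  interpret D: right_module A D by fact
  interpret M: right_module A M by fact
  interpret f: abelian_group_hom P D f by (rule rmod_hom_abelian_group_hom[OF P D f])
  interpret s: abelian_group_hom P M \<sigma> by (rule rmod_hom_abelian_group_hom[OF P M \<sigma>])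
  have f_act: "f (p \<leftharpoonup>\<^bsub>P\<^esub> a) = f p \<leftharpoonup>\<^bsub>D\<^esub> a" and s_act: "\<sigma> (p \<leftharpoonup>\<^bsub>P\<^esub> a) = \<sigma> p \<leftharpoonup>\<^bsub>M\<^esub> a"
    if "p \<in> carrier P" "a \<in> carrier A" for p a
    using f \<sigma> that by (auto simp: rmod_hom_def)
  define K where "K = f ` a_kernel P M \<sigma>"
  let ?Q = "quotient_rmod D K"
  have K_sub: "additive_subgroup K D"
    unfolding K_def using group_hom.subgroup_img_is_subgroup[OF f.a_group_hom]
      additive_subgroup.a_subgroup[OF s.additive_subgroup_a_kernel]
    by (intro additive_subgroupI)
  have K: "rsubmodule A K D"
    unfolding rsubmodule_def
  proof (intro conjI ballI K_sub)
    fix n a assume "n \<in> K" "a \<in> carrier A"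
    then obtain p where "p \<in> carrier P" "\<sigma> p = \<zero>\<^bsub>M\<^esub>" "n = f p" by (auto simp: K_def a_kernel_def')
    then have "n \<leftharpoonup>\<^bsub>D\<^esub> a = f (p \<leftharpoonup>\<^bsub>P\<^esub> a)" "p \<leftharpoonup>\<^bsub>P\<^esub> a \<in> a_kernel P M \<sigma>"
      using \<open>a \<in> carrier A\<close> by (auto simp: f_act s_act a_kernel_def')
    then show "n \<leftharpoonup>\<^bsub>D\<^esub> a \<in> K" by (simp add: K_def)
  qed
  interpret K: abelian_subgroup K D
    using K_sub D.abelian_group_axioms by (rule abelian_subgroupI3)
  have Q: "abelian_group ?Q"
    by (rule abelian_group_from_comm_group[OF K.a_factorgroup_is_comm_group])
      (simp_all add: A_FactGroup_def' quotient_rmod_def)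
  define q where "q = (\<lambda>p. K +>\<^bsub>D\<^esub> f p)"
  have q_hom: "abelian_group_hom P ?Q q"
    by (rule abelian_group_homI'[OF P.M.abelian_group_axioms Q])
      (auto simp: q_def quotient_rmod_def K.a_rcos_sum intro!: D.a_rcosetsI K.a_subset)
  have q_act: "q (p \<leftharpoonup>\<^bsub>P\<^esub> a) = q p \<leftharpoonup>\<^bsub>?Q\<^esub> a" if "p \<in> carrier P" "a \<in> carrier A" for p a
    using that rsmult_quotient_coset[OF D K] by (simp add: q_def f_act)
  interpret q: abelian_group_hom P ?Q q by (rule q_hom)
  define N where "N = q ` carrier P"
  have N: "rsubmodule A N ?Q"
    unfolding rsubmodule_def
  proof (intro conjI ballI)
    show "additive_subgroup N ?Q"
      unfolding N_def using group_hom.img_is_subgroup[OF q.a_group_hom]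
      by (intro additive_subgroupI) simp
    show "n \<leftharpoonup>\<^bsub>?Q\<^esub> a \<in> N" if "n \<in> N" "a \<in> carrier A" for n a
      using that by (auto simp: N_def q_act[symmetric])
  qed
  \<comment> \<open>Equality of the cosets means that f (p - p') lies in f (ker \<sigma>). This is
    the point where the inclusion of kernels enters, and everything below rests on it:
    well-definedness and injectivity of the isomorphism are its two directions.\<close>
  have q_eq_iff: "q p = q p' \<longleftrightarrow> \<sigma> p = \<sigma> p'" if p: "p \<in> carrier P" "p' \<in> carrier P" for p p'
  proof -
    have s_diff: "\<sigma> (u \<ominus>\<^bsub>P\<^esub> v) = \<zero>\<^bsub>M\<^esub> \<longleftrightarrow> \<sigma> u = \<sigma> v" if "u \<in> carrier P" "v \<in> carrier P" for u v
      using that M.M.minus_eq_zero_iff[of "\<sigma> u" "\<sigma> v"] by (simp add: P.M.minus_eq M.M.minus_eq)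
    \<comment> \<open>u need not be the preimage k of f u that lies in ker \<sigma>, but u - k is in
      ker f and hence also in ker \<sigma>.\<close>
    have s_zero: "\<sigma> u = \<zero>\<^bsub>M\<^esub>" if u: "u \<in> carrier P" "f u \<in> K" for u
    proof -
      obtain k where k: "k \<in> carrier P" "\<sigma> k = \<zero>\<^bsub>M\<^esub>" "f u = f k"
        using u(2) by (auto simp: K_def a_kernel_def')
      then have "f (u \<ominus>\<^bsub>P\<^esub> k) = \<zero>\<^bsub>D\<^esub>" using that(1) by (simp add: P.M.minus_eq D.r_neg)
      then have "\<sigma> (u \<ominus>\<^bsub>P\<^esub> k) = \<zero>\<^bsub>M\<^esub>" using k that(1) by (intro ker) auto
      then show ?thesis using k that(1) s_diff by simp
    qed
    have "q p = q p' \<longleftrightarrow> f p \<in> K +>\<^bsub>D\<^esub> f p'"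
      using p K.a_repr_independence' K.a_rcos_self unfolding q_def by (metis f.hom_closed)
    also have "\<dots> \<longleftrightarrow> f p \<oplus>\<^bsub>D\<^esub> \<ominus>\<^bsub>D\<^esub> f p' \<in> K"
      using p by (intro K.a_rcos_module) auto
    also have "f p \<oplus>\<^bsub>D\<^esub> \<ominus>\<^bsub>D\<^esub> f p' = f (p \<ominus>\<^bsub>P\<^esub> p')" using p by (simp add: P.M.minus_eq)
    also have "f (p \<ominus>\<^bsub>P\<^esub> p') \<in> K \<longleftrightarrow> \<sigma> (p \<ominus>\<^bsub>P\<^esub> p') = \<zero>\<^bsub>M\<^esub>"
      using s_zero[of "p \<ominus>\<^bsub>P\<^esub> p'"] p by (auto simp: K_def a_kernel_def')
    also have "\<dots> \<longleftrightarrow> \<sigma> p = \<sigma> p'"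
      using p by (rule s_diff)
    finally show ?thesis .
  qed
  \<comment> \<open>An arbitrary section of \<sigma>. It is neither additive nor linear in general;
    \<open>q_eq_iff\<close> makes its composite with q so.\<close>
  define \<tau> where "\<tau> m = (SOME p. p \<in> carrier P \<and> \<sigma> p = m)" for m
  have \<tau>: "\<tau> m \<in> carrier P" "\<sigma> (\<tau> m) = m" if "m \<in> carrier M" for m
    using someI_ex[of "\<lambda>p. p \<in> carrier P \<and> \<sigma> p = m"] surj[OF that] unfolding \<tau>_def by blast+
  have "(\<lambda>m. q (\<tau> m)) \<in> rmod_iso A M (?Q\<lparr>carrier := N\<rparr>)"
    unfolding rmod_iso_def mem_Collect_eq
  proof (intro conjI ballI)
    show "bij_betw (\<lambda>m. q (\<tau> m)) (carrier M) (carrier (?Q\<lparr>carrier := N\<rparr>))"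
      unfolding bij_betw_def
    proof
      show "inj_on (\<lambda>m. q (\<tau> m)) (carrier M)"
        by (rule inj_onI) (use q_eq_iff \<tau> in metis)
      have "q p \<in> (\<lambda>m. q (\<tau> m)) ` carrier M" if "p \<in> carrier P" for p
        using that q_eq_iff[of p "\<tau> (\<sigma> p)"] \<tau>[of "\<sigma> p"] by (intro image_eqI[of _ _ "\<sigma> p"]) auto
      then show "(\<lambda>m. q (\<tau> m)) ` carrier M = carrier (?Q\<lparr>carrier := N\<rparr>)"
        using \<tau> by (auto simp: N_def)
    qed
    fix x assume x: "x \<in> carrier M"
    show "q (\<tau> (x \<oplus>\<^bsub>M\<^esub> y)) = q (\<tau> x) \<oplus>\<^bsub>?Q\<lparr>carrier := N\<rparr>\<^esub> q (\<tau> y)" if y: "y \<in> carrier M" for y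
    proof -
      have "q (\<tau> (x \<oplus>\<^bsub>M\<^esub> y)) = q (\<tau> x \<oplus>\<^bsub>P\<^esub> \<tau> y)"
        using x y \<tau> by (subst q_eq_iff) auto
      then show ?thesis using x y \<tau> by simp
    qed
    show "q (\<tau> (x \<leftharpoonup>\<^bsub>M\<^esub> a)) = q (\<tau> x) \<leftharpoonup>\<^bsub>?Q\<lparr>carrier := N\<rparr>\<^esub> a" if a: "a \<in> carrier A" for a
    proof -
      have "q (\<tau> (x \<leftharpoonup>\<^bsub>M\<^esub> a)) = q (\<tau> x \<leftharpoonup>\<^bsub>P\<^esub> a)"
        using x a \<tau> by (subst q_eq_iff) (auto simp: s_act)
      then show ?thesis using x a \<tau> by (simp add: q_act)
    qed
  qed
  then show ?thesis using K N by blast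
qed

text \<open>Choose a representative d of the coset corresponding to m and let F consist of its
  nonzero components, finite in number. If a kills F, then d a = 0, so m a corresponds to the zero
  coset. The argument works for index sets in any type.\<close>

lemma subgenerated_annihilator:
  fixes A :: "('a, 'x) ring_scheme" and C :: "('a, 'c, 'y) rmod_scheme" and M :: "('a, 'm, 'z) rmod_scheme"
  assumes C: "right_module A C" and M: "right_module A M"
    and sub: "subgenerated TYPE('i) A C M" and m: "m \<in> carrier M"
  shows "\<exists>F. finite F \<and> F \<subseteq> carrier C \<and> annihilator A C F \<subseteq> annihilator A M {m}"
proof -
  interpret C: right_module A C by fact
  interpret M: right_module A M by fact
  obtain I :: "'i set" and K N h where
    K: "rsubmodule A K (direct_sum_copies I C)" and
    N: "rsubmodule A N (quotient_rmod (direct_sum_copies I C) K)" and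
    h: "h \<in> rmod_iso A M ((quotient_rmod (direct_sum_copies I C) K)\<lparr>carrier := N\<rparr>)"
    using sub unfolding subgenerated_def by blast
  let ?D = "direct_sum_copies I C" and ?Q = "quotient_rmod (direct_sum_copies I C) K"
  have D: "right_module A ?D" by (rule right_module_direct_sum_copies[OF C])
  interpret D: right_module A ?D by (rule D)
  have "h m \<in> N" using h m by (auto simp: rmod_iso_def bij_betw_def)
  then have "h m \<in> a_rcosets\<^bsub>?D\<^esub> K"
    using additive_subgroup.a_subset[of N ?Q] N by (auto simp: rsubmodule_def quotient_rmod_def)
  then obtain d where d: "d \<in> carrier ?D" "h m = K +>\<^bsub>?D\<^esub> d" by (auto simp: A_RCOSETS_def')
  let ?F = "d ` {i \<in> I. d i \<noteq> \<zero>\<^bsub>C\<^esub>}"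
  have F: "finite ?F" "?F \<subseteq> carrier C" using d(1) by (auto simp: direct_sum_copies_def)
  have hact: "h (m \<leftharpoonup>\<^bsub>M\<^esub> a) = K +>\<^bsub>?D\<^esub> \<zero>\<^bsub>?D\<^esub>" if "a \<in> annihilator A C ?F" for a
  proof -
    have a: "a \<in> carrier A" using that by (simp add: annihilator_def)
    have "d i \<leftharpoonup>\<^bsub>C\<^esub> a = \<zero>\<^bsub>C\<^esub>" if "i \<in> I" for i
      using that a \<open>a \<in> annihilator A C ?F\<close> by (cases "d i = \<zero>\<^bsub>C\<^esub>") (auto simp: annihilator_def)
    then have "d \<leftharpoonup>\<^bsub>?D\<^esub> a = \<zero>\<^bsub>?D\<^esub>" by (auto simp: direct_sum_copies_def)
    moreover have "h (m \<leftharpoonup>\<^bsub>M\<^esub> a) = h m \<leftharpoonup>\<^bsub>?Q\<^esub> a" using h m a by (simp add: rmod_iso_def)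
    ultimately show ?thesis using rsmult_quotient_coset[OF D K d(1) a] d(2) by simp
  qed
  have "m \<leftharpoonup>\<^bsub>M\<^esub> a = \<zero>\<^bsub>M\<^esub>" if "a \<in> annihilator A C ?F" for a
  proof -
    have a: "a \<in> carrier A" using that by (simp add: annihilator_def)
    have "\<zero>\<^bsub>A\<^esub> \<in> annihilator A C ?F" using F(2) by (auto simp: annihilator_def)
    then have eq: "h (m \<leftharpoonup>\<^bsub>M\<^esub> a) = h (m \<leftharpoonup>\<^bsub>M\<^esub> \<zero>\<^bsub>A\<^esub>)" using hact that by simp
    have "inj_on h (carrier M)" using h by (simp add: rmod_iso_def bij_betw_def)
    from inj_onD[OF this eq] have "m \<leftharpoonup>\<^bsub>M\<^esub> a = m \<leftharpoonup>\<^bsub>M\<^esub> \<zero>\<^bsub>A\<^esub>" using m a by auto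
    then show ?thesis using m by simp
  qed
  then have "annihilator A C ?F \<subseteq> annihilator A M {m}" by (auto simp: annihilator_def)
  then show ?thesis using F by blast
qed

text \<open>Choose elements \<open>c\<^sub>m\<^sub>,\<^sub>i\<close> (\<open>m \<in> M\<close>, finitely many nonzero for each \<open>m\<close>) whose joint
  annihilator annihilates \<open>m\<close>; the free module \<open>P\<close> on \<open>M\<close> maps onto \<open>M\<close>, and to the direct sum
  of copies of \<open>C\<close> by sending the basis element \<open>m\<close> to \<open>(c\<^sub>m\<^sub>,\<^sub>i)\<^sub>i\<close>.\<close>

lemma subgenerated_if_annihilators:
  fixes A :: "('a, 'x) ring_scheme" and C :: "('a, 'c, 'y) rmod_scheme" and M :: "('a, 'm, 'z) rmod_scheme"
  assumes C: "right_module A C" and M: "right_module A M"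
    and ann: "\<And>m. m \<in> carrier M \<Longrightarrow>
      \<exists>F. finite F \<and> F \<subseteq> carrier C \<and> annihilator A C F \<subseteq> annihilator A M {m}"
  shows "subgenerated TYPE('m \<times> nat) A C M"
proof -
  interpret C: right_module A C by fact
  interpret M: right_module A M by fact
  have "\<exists>xs. set xs \<subseteq> carrier C \<and> annihilator A C (set xs) \<subseteq> annihilator A M {m}"
    if "m \<in> carrier M" for m
    using ann[OF that] finite_list by metis
  then obtain xs where xs: "\<And>m. m \<in> carrier M \<Longrightarrow> set (xs m) \<subseteq> carrier C"
    "\<And>m. m \<in> carrier M \<Longrightarrow> annihilator A C (set (xs m)) \<subseteq> annihilator A M {m}"
    by metis
  \<comment> \<open>The finite set attached to m is listed and padded with zeros, so that every m
    uses the same index set of natural numbers. The padding affects neither finiteness of support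
    nor annihilators.\<close>
  define c where "c m i = (if i < length (xs m) then xs m ! i else \<zero>\<^bsub>C\<^esub>)" for m i
  have c_closed [simp]: "c m i \<in> carrier C" if "m \<in> carrier M" for m i
    using xs(1)[OF that] nth_mem[of i "xs m"] by (auto simp: c_def)
  define I where "I = carrier M \<times> (UNIV :: nat set)"
  \<comment> \<open>The free right A-module on the set \<open>carrier M\<close>, as finitely
    supported functions.\<close>
  define P where "P = direct_sum_copies (carrier M) (regular_bimod A)"
  have P: "right_module A P"
    unfolding P_def by (rule right_module_direct_sum_copies[OF right_module_regular[OF C.R.ring_axioms]])
  have D: "right_module A (direct_sum_copies I C)" by (rule right_module_direct_sum_copies[OF C])
  define supp where "supp p = {m \<in> carrier M. p m \<noteq> \<zero>\<^bsub>A\<^esub>}" for p :: "'m \<Rightarrow> 'a"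
  have P_carrier: "p \<in> carrier P \<longleftrightarrow> p \<in> carrier M \<rightarrow>\<^sub>E carrier A \<and> finite (supp p)" for p
    by (simp add: P_def direct_sum_copies_def regular_bimod_def supp_def)
  have P_add: "p \<oplus>\<^bsub>P\<^esub> q = (\<lambda>m\<in>carrier M. p m \<oplus>\<^bsub>A\<^esub> q m)"
    and P_act: "p \<leftharpoonup>\<^bsub>P\<^esub> a = (\<lambda>m\<in>carrier M. p m \<otimes>\<^bsub>A\<^esub> a)" for p q a
    by (simp_all add: P_def direct_sum_copies_def regular_bimod_def)
  have P_mem: "p m \<in> carrier A" if "p \<in> carrier P" "m \<in> carrier M" for p m
    using that by (auto simp: P_carrier)

  define f where "f p = (\<lambda>(m, i)\<in>I. c m i \<leftharpoonup>\<^bsub>C\<^esub> p m)" for p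
  have f: "f \<in> rmod_hom A P (direct_sum_copies I C)"
    unfolding rmod_hom_def mem_Collect_eq
  proof (intro conjI ballI Pi_I)
    fix p assume p: "p \<in> carrier P"
    \<comment> \<open>A nonzero component at (m, i) requires p m to be nonzero and i to lie before
      the padding, which leaves finitely many indices.\<close>
    have "{j \<in> I. f p j \<noteq> \<zero>\<^bsub>C\<^esub>} \<subseteq> (\<Union>m\<in>supp p. Pair m ` {..<length (xs m)})"
    proof
      fix j assume "j \<in> {j \<in> I. f p j \<noteq> \<zero>\<^bsub>C\<^esub>}"
      then obtain m i where j: "j = (m, i)" "m \<in> carrier M" "c m i \<leftharpoonup>\<^bsub>C\<^esub> p m \<noteq> \<zero>\<^bsub>C\<^esub>"
        by (auto simp: I_def f_def)
      then have "p m \<noteq> \<zero>\<^bsub>A\<^esub>" using c_closed C.rsmult_zero_right by metis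
      moreover have "i < length (xs m)"
        using j(2,3) P_mem[OF p] by (simp add: c_def split: if_splits)
      ultimately show "j \<in> (\<Union>m\<in>supp p. Pair m ` {..<length (xs m)})" using j by (auto simp: supp_def)
    qed
    moreover have "finite (\<Union>m\<in>supp p. Pair m ` {..<length (xs m)})" using p by (simp add: P_carrier)
    ultimately have "finite {j \<in> I. f p j \<noteq> \<zero>\<^bsub>C\<^esub>}" by (rule finite_subset)
    then show "f p \<in> carrier (direct_sum_copies I C)"
      using P_mem[OF p] by (auto simp: direct_sum_copies_def f_def I_def)
    show "f (p \<oplus>\<^bsub>P\<^esub> q) = f p \<oplus>\<^bsub>direct_sum_copies I C\<^esub> f q" if "q \<in> carrier P" for q
      using p that P_mem
      by (auto simp: fun_eq_iff f_def I_def P_add direct_sum_copies_def C.rsmult_r_distr)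
    show "f (p \<leftharpoonup>\<^bsub>P\<^esub> a) = f p \<leftharpoonup>\<^bsub>direct_sum_copies I C\<^esub> a" if "a \<in> carrier A" for a
      using p that P_mem
      by (auto simp: fun_eq_iff f_def I_def P_act direct_sum_copies_def C.rsmult_assoc)
  qed

  define \<sigma> where "\<sigma> p = (\<Oplus>\<^bsub>M\<^esub>m\<in>supp p. m \<leftharpoonup>\<^bsub>M\<^esub> p m)" for p
  \<comment> \<open>The support varies with p, so sums for different elements are first extended to
    a common finite set.\<close>
  have \<sigma>_superset: "\<sigma> p = (\<Oplus>\<^bsub>M\<^esub>m\<in>S. m \<leftharpoonup>\<^bsub>M\<^esub> p m)"
    if "p \<in> carrier P" "finite S" "supp p \<subseteq> S" "S \<subseteq> carrier M" for p S
    unfolding \<sigma>_def using that P_mem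
    by (intro M.add.finprod_mono_neutral_cong_left) (auto simp: supp_def subset_iff)
  have \<sigma>: "\<sigma> \<in> rmod_hom A P M"
    unfolding rmod_hom_def mem_Collect_eq
  proof (intro conjI ballI Pi_I)
    fix p assume p: "p \<in> carrier P"
    show "\<sigma> p \<in> carrier M"
      unfolding \<sigma>_def using P_mem[OF p] by (intro M.finsum_closed) (auto simp: supp_def)
    show "\<sigma> (p \<oplus>\<^bsub>P\<^esub> q) = \<sigma> p \<oplus>\<^bsub>M\<^esub> \<sigma> q" if q: "q \<in> carrier P" for q
    proof -
      let ?S = "supp p \<union> supp q"
      have pq: "p \<oplus>\<^bsub>P\<^esub> q \<in> carrier P"
        using p q abelian_monoid.a_closed[OF abelian_group.axioms(1)[OF right_module.axioms(2)[OF P]]] by blast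
      have S: "finite ?S" "?S \<subseteq> carrier M" using p q by (auto simp: P_carrier supp_def)
      have "supp (p \<oplus>\<^bsub>P\<^esub> q) \<subseteq> ?S" by (auto simp: supp_def P_add)
      then have "\<sigma> (p \<oplus>\<^bsub>P\<^esub> q) = (\<Oplus>\<^bsub>M\<^esub>m\<in>?S. m \<leftharpoonup>\<^bsub>M\<^esub> (p \<oplus>\<^bsub>P\<^esub> q) m)"
        using pq S by (intro \<sigma>_superset) auto
      also have "\<dots> = (\<Oplus>\<^bsub>M\<^esub>m\<in>?S. m \<leftharpoonup>\<^bsub>M\<^esub> p m \<oplus>\<^bsub>M\<^esub> m \<leftharpoonup>\<^bsub>M\<^esub> q m)"
        using S(2) P_mem p q by (intro M.finsum_cong') (auto simp: P_add M.rsmult_r_distr subset_iff)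
      also have "\<dots> = \<sigma> p \<oplus>\<^bsub>M\<^esub> \<sigma> q"
        using S P_mem p q \<sigma>_superset[OF p, of ?S] \<sigma>_superset[OF q, of ?S]
        by (subst M.finsum_addf) (auto simp: subset_iff)
      finally show ?thesis .
    qed
    show "\<sigma> (p \<leftharpoonup>\<^bsub>P\<^esub> a) = \<sigma> p \<leftharpoonup>\<^bsub>M\<^esub> a" if a: "a \<in> carrier A" for a
    proof -
      have pa: "p \<leftharpoonup>\<^bsub>P\<^esub> a \<in> carrier P" using right_module.rsmult_closed[OF P p a] .
      have S: "finite (supp p)" "supp p \<subseteq> carrier M" using p by (auto simp: P_carrier supp_def)
      have "supp (p \<leftharpoonup>\<^bsub>P\<^esub> a) \<subseteq> supp p" using a by (auto simp: supp_def P_act)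
      then have "\<sigma> (p \<leftharpoonup>\<^bsub>P\<^esub> a) = (\<Oplus>\<^bsub>M\<^esub>m\<in>supp p. m \<leftharpoonup>\<^bsub>M\<^esub> (p \<leftharpoonup>\<^bsub>P\<^esub> a) m)"
        using pa S by (intro \<sigma>_superset) auto
      also have "\<dots> = (\<Oplus>\<^bsub>M\<^esub>m\<in>supp p. (m \<leftharpoonup>\<^bsub>M\<^esub> p m) \<leftharpoonup>\<^bsub>M\<^esub> a)"
        using S(2) P_mem p a by (intro M.finsum_cong') (auto simp: P_act M.rsmult_assoc subset_iff)
      also have "\<dots> = (\<Oplus>\<^bsub>M\<^esub>m\<in>supp p. m \<leftharpoonup>\<^bsub>M\<^esub> p m) \<leftharpoonup>\<^bsub>M\<^esub> a"
        using S
      proof (induction rule: finite_induct)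
        case empty
        then show ?case using a by simp
      next
        case (insert m S)
        then show ?case
          using P_mem[OF p] a M.finsum_closed[of "\<lambda>m. m \<leftharpoonup>\<^bsub>M\<^esub> p m" S]
          by (simp add: Pi_def subset_iff M.rsmult_l_distr)
      qed
      finally show ?thesis by (simp add: \<sigma>_def)
    qed
  qed

  have surj: "\<exists>p\<in>carrier P. \<sigma> p = m" if m: "m \<in> carrier M" for m
  proof -
    define p where "p = (\<lambda>n\<in>carrier M. if n = m then \<one>\<^bsub>A\<^esub> else \<zero>\<^bsub>A\<^esub>)"
    have supp: "supp p \<subseteq> {m}" by (auto simp: supp_def p_def)
    have p: "p \<in> carrier P"
      using finite_subset[OF supp] by (auto simp: P_carrier p_def)
    then have "\<sigma> p = (\<Oplus>\<^bsub>M\<^esub>n\<in>{m}. n \<leftharpoonup>\<^bsub>M\<^esub> p n)" using supp m by (intro \<sigma>_superset) auto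
    also have "\<dots> = m" using m M.finsum_insert[of "{}" m "\<lambda>n. n \<leftharpoonup>\<^bsub>M\<^esub> p n"] by (simp add: p_def)
    finally show ?thesis using p by blast
  qed

  have ker: "\<sigma> p = \<zero>\<^bsub>M\<^esub>" if p: "p \<in> carrier P" and fp: "f p = \<zero>\<^bsub>direct_sum_copies I C\<^esub>" for p
  proof -
    have "m \<leftharpoonup>\<^bsub>M\<^esub> p m = \<zero>\<^bsub>M\<^esub>" if m: "m \<in> carrier M" for m
    proof -
      \<comment> \<open>Since the components for different m are kept apart, f p = 0 says that each
        p m separately annihilates the list of m. Hence every term of the sum \<sigma> p vanishes,
        not only the sum.\<close>
      have "c m i \<leftharpoonup>\<^bsub>C\<^esub> p m = \<zero>\<^bsub>C\<^esub>" for i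
        using fun_cong[OF fp, of "(m, i)"] m by (simp add: f_def I_def direct_sum_copies_def)
      then have "x \<leftharpoonup>\<^bsub>C\<^esub> p m = \<zero>\<^bsub>C\<^esub>" if "x \<in> set (xs m)" for x
        using that unfolding c_def in_set_conv_nth by metis
      then have "p m \<in> annihilator A C (set (xs m))" using P_mem[OF p m] by (simp add: annihilator_def)
      then show ?thesis using xs(2)[OF m] by (auto simp: annihilator_def)
    qed
    then show ?thesis unfolding \<sigma>_def by (intro M.add.finprod_one_eqI) (auto simp: supp_def)
  qed

  show ?thesis
    using rmod_iso_subquotient[OF P D M f \<sigma> surj ker] unfolding subgenerated_def by blast
qed

section \<open>The topologies of the pairing and their discrete modules\<close>

context measuring_left_pairing
begin

lemma weak_linear_topology_eq_adic:
  "weak_linear_topology R A C \<kappa> = adic_topology A (pairing_module C \<kappa>)"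
proof -
  let ?C = "pairing_module C \<kappa>"
  have C: "carrier ?C = carrier C" "\<zero>\<^bsub>?C\<^esub> = \<zero>\<^bsub>C\<^esub>" by (simp_all add: pairing_module_def)
  show ?thesis
    unfolding weak_linear_topology_def adic_topology_def C(1)
  proof (rule linear_topology_cong)
    fix V assume "V \<in> {annihilating_perp R A \<kappa> F |F. finite F \<and> F \<subseteq> carrier C}"
    then obtain F where F: "finite F" "F \<subseteq> carrier C" "V = annihilating_perp R A \<kappa> F" by blast
    have "\<kappa> a c = \<zero>\<^bsub>R\<^esub>" if "a \<in> carrier A" "c \<in> carrier C" "act c a = \<zero>\<^bsub>C\<^esub>" for a c
      using counit_act[OF that(1,2)] that(3) abelian_group_hom.hom_zero[OF C.counit_group_hom] by simp
    then have "annihilator A ?C F \<subseteq> V"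
      using F by (auto simp: annihilator_def annihilating_perp_def C)
    then show "\<exists>W\<in>{annihilator A ?C F |F. finite F \<and> F \<subseteq> carrier C}. W \<subseteq> V" using F by blast
  next
    fix W assume "W \<in> {annihilator A ?C F |F. finite F \<and> F \<subseteq> carrier C}"
    then obtain F where F: "finite F" "F \<subseteq> carrier C" "W = annihilator A ?C F" by blast
    have "\<exists>G. finite G \<and> G \<subseteq> carrier C \<and>
        (\<forall>a\<in>carrier A. (\<forall>d\<in>G. \<kappa> a d = \<zero>\<^bsub>R\<^esub>) \<longrightarrow> act c a = \<zero>\<^bsub>C\<^esub>)" if "c \<in> F" for c
      by (rule act_eq_zero_if_annihilated) (use F(2) that in blast)
    then obtain G where G: "\<And>c. c \<in> F \<Longrightarrow> finite (G c) \<and> G c \<subseteq> carrier C \<and>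
        (\<forall>a\<in>carrier A. (\<forall>d\<in>G c. \<kappa> a d = \<zero>\<^bsub>R\<^esub>) \<longrightarrow> act c a = \<zero>\<^bsub>C\<^esub>)"
      by metis
    \<comment> \<open>The sets G c were chosen uniformly in a, so one finite union over F handles
      all a at once.\<close>
    have "annihilating_perp R A \<kappa> (\<Union>c\<in>F. G c) \<subseteq> W"
      using G F(3) by (auto simp: annihilator_def annihilating_perp_def C)
    moreover have "finite (\<Union>c\<in>F. G c)" "(\<Union>c\<in>F. G c) \<subseteq> carrier C" using F G by auto
    ultimately show "\<exists>V\<in>{annihilating_perp R A \<kappa> F |F. finite F \<and> F \<subseteq> carrier C}. V \<subseteq> W" by blast
  qed
qed

interpretation P: right_module A "pairing_module C \<kappa>"
  by (rule right_module_pairing)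

interpretation base: right_ideal_base A
  "{annihilator A (pairing_module C \<kappa>) F | F. finite F \<and> F \<subseteq> carrier (pairing_module C \<kappa>)}"
  by (rule P.right_ideal_base_annihilator)

lemma right_linear_topological_adic:
  "right_linear_topological_r_ring R A (adic_topology A (pairing_module C \<kappa>))"
  unfolding right_linear_topological_r_ring_def adic_topology_def
  using A.r_ring_axioms base.topological_ring base.nbhd_base_at_zero base.base_right_ideal by blast

text \<open>Annihilators of single elements are additive subgroups, so they are open exactly when
  they contain a basic right ideal. The resulting condition is the one that the lemmas on
  subgeneration use.\<close>

lemma discrete_module_adic_iff:
  assumes "right_module A M"
  shows "discrete_module A (adic_topology A (pairing_module C \<kappa>)) M \<longleftrightarrow>
    (\<forall>m\<in>carrier M. \<exists>F. finite F \<and> F \<subseteq> carrier (pairing_module C \<kappa>) \<and>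
      annihilator A (pairing_module C \<kappa>) F \<subseteq> annihilator A M {m})"
proof -
  have "openin (adic_topology A (pairing_module C \<kappa>)) (annihilator A M {m}) \<longleftrightarrow>
    (\<exists>F. finite F \<and> F \<subseteq> carrier (pairing_module C \<kappa>) \<and>
      annihilator A (pairing_module C \<kappa>) F \<subseteq> annihilator A M {m})" if "m \<in> carrier M" for m
    unfolding adic_topology_def
    using that base.openin_additive_subgroup_iff[OF right_module.annihilator_subgroup[OF assms]] by auto
  then show ?thesis by (simp add: discrete_module_def)
qed

end

theorem lemma1p25:
  fixes R :: "'r ring"
    and A :: "('r, 'a) bimod"
    and C :: "('r, 'c) coring"
    and \<kappa> :: "'a \<Rightarrow> 'c \<Rightarrow> 'r"
  assumes "measuring_left_pairing R A C \<kappa>"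
  shows "weak_linear_topology R A C \<kappa> = adic_topology A (pairing_module C \<kappa>)
    \<and> right_linear_topological_r_ring R A (weak_linear_topology R A C \<kappa>)
    \<and> (\<forall>M :: ('a, 'm) rmod. right_module A M \<longrightarrow>
         (discrete_module A (weak_linear_topology R A C \<kappa>) M
            \<longleftrightarrow> subgenerated TYPE('m \<times> nat) A (pairing_module C \<kappa>) M)
       \<and> (subgenerated TYPE('i) A (pairing_module C \<kappa>) M
            \<longrightarrow> discrete_module A (weak_linear_topology R A C \<kappa>) M))"
proof -
  interpret measuring_left_pairing R A C \<kappa> by fact
  note C = right_module_pairing
  show ?thesis
    unfolding weak_linear_topology_eq_adic
  proof (intro conjI allI impI refl right_linear_topological_adic)
    fix M :: "('a, 'm) rmod" assume M: "right_module A M"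
    show "discrete_module A (adic_topology A (pairing_module C \<kappa>)) M \<longleftrightarrow>
        subgenerated TYPE('m \<times> nat) A (pairing_module C \<kappa>) M"
      unfolding discrete_module_adic_iff[OF M]
      using subgenerated_annihilator[OF C M] subgenerated_if_annihilators[OF C M] by blast
    \<comment> \<open>Here the index type is arbitrary. Combined with the equivalence for
      \<open>'m \<times> nat\<close>, this shows that no other index type produces further
      subgenerated modules.\<close>
    show "discrete_module A (adic_topology A (pairing_module C \<kappa>)) M"
      if "subgenerated TYPE('i) A (pairing_module C \<kappa>) M"
      unfolding discrete_module_adic_iff[OF M]
      using subgenerated_annihilator[OF C M that] by blast
  qed
qed

end
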